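(* Let $P$ be a closed process (no free variables) which is typed, i.e. $\vdash P\triangleright\mathtt{l}:T,\mathtt{r}:S$ is derivable in the empty environment for some session types $T,S$. If $P\rightsquigarrow^* Q$, then $P\approx Q$.
   Context: Channels: $\mathsf{c}\in\{\mathtt{l},\mathtt{r}\}$, with $\bar{\mathtt{l}}=\mathtt{r}$, $\bar{\mathtt{r}}=\mathtt{l}$; selectors $\ell\in\{\mathsf{inl},\mathsf{inr}\}$. Basic types include $\mathsf{unit}$ (value $()$), $\mathsf{bool}$ ($\mathsf{true},\mathsf{false}$), $\mathsf{int}$ (integers); $v\in t$ means basic value $v$ has basic type $t$. Expressions $e$: variables, basic values, $e_1=e_2$; deterministic evaluation $e\Downarrow v$. Processes: $P ::= \mathbf{0} \mid \mathsf{c}?(x:t).P \mid \mathsf{c}!e.P \mid \mathsf{c}\triangleleft\ell.P \mid \mathsf{c}\triangleright\{P,Q\} \mid \mathsf{if}\ e\ \mathsf{then}\ P\ \mathsf{else}\ Q \mid P\bowtie Q$ (the branching has $\mathsf{inl}$-branch $P$ and $\mathsf{inr}$-branch $Q$; in $P\bowtie Q$ the channel $\mathtt{r}$ of $P$ is connected to the channel $\mathtt{l}$ of $Q$). Structural congruence $\equiv$: least congruence with $\mathbf{0}\bowtie\mathbf{0}\equiv\mathbf{0}$ and associativity of $\bowtie$. Reduction contexts $\mathcal{C}::=[\,]\mid\mathcal{C}\bowtie P\mid P\bowtie\mathcal{C}$. Reduction $\longrightarrow$: least relation with $\mathtt{r}!e.P\bowtie\mathtt{l}?(x:t).Q\longrightarrow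 P\bowtie Q\{v/x\}$ and $\mathtt{r}?(x:t).P\bowtie\mathtt{l}!e.Q\longrightarrow P\{v/x\}\bowtie Q$ (when $e\Downarrow v$, $v\in t$); $\mathtt{r}\triangleleft\ell.P\bowtie\mathtt{l}\triangleright\{Q_{\mathsf{inl}},Q_{\mathsf{inr}}\}\longrightarrow P\bowtie Q_\ell$; $\mathtt{r}\triangleright\{P_{\mathsf{inl}},P_{\mathsf{inr}}\}\bowtie\mathtt{l}\triangleleft\ell.Q\longrightarrow P_\ell\bowtie Q$; $\mathsf{if}\ e\ \mathsf{then}\ P_{\mathsf{true}}\ \mathsf{else}\ P_{\mathsf{false}}\longrightarrow P_v$ (when $e\Downarrow v\in\mathsf{bool}$); closed under reduction contexts and under $\equiv$. A process $P$ is correct if $P\longrightarrow^*Q\not\longrightarrow$ implies $Q\equiv\mathbf{0}$. Equivalence: $P\approx Q$ iff for every reduction context $\mathcal{C}$, $\mathcal{C}[P]$ is correct iff $\mathcal{C}[Q]$ is correct. Session types $T::=\mathtt{end}\mid ?t.T\mid !t.T\mid T+S\mid T\oplus S$; dual $\overline{T}$ swaps $?$ with $!$ and $+$ with $\oplus$. Typing judgment $\Gamma\vdash P\triangleright\mathsf{c}:T,\bar{\mathsf{c}}:S$ ($\Gamma$ maps variables to basic types), with rules: variables/values/equality typed as usual ($\Gamma,x:t\vdash x:t$; $\Gamma\vdash v:t$ if $v\in t$; $e_1=e_2:\mathsf{bool}$ if both sides have a common type); input $\mathsf{c}?(x:t).P$ has $\mathsf{c}:?t.T$ if $P$ has $\mathsf{c}:T$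 under $\Gamma,x:t$ (type of $\bar{\mathsf c}$ unchanged); output $\mathsf{c}!e.P$ has $\mathsf{c}:!t.T$ if $\Gamma\vdash e:t$ and $P$ has $\mathsf{c}:T$; branching $\mathsf{c}\triangleright\{P_1,P_2\}$ has $\mathsf{c}:T_1+T_2$ if $P_i$ has $\mathsf{c}:T_i$ (same type for $\bar{\mathsf c}$); $\mathsf{c}\triangleleft\mathsf{inl}.P$ (resp. $\mathsf{inr}$) has $\mathsf{c}:T_1\oplus T_2$ if $P$ has $\mathsf{c}:T_1$ (resp. $T_2$); $\mathbf{0}$ has $\mathtt{l}:\mathtt{end},\mathtt{r}:\mathtt{end}$; a conditional with boolean guard has $\mathtt{l}:T,\mathtt{r}:S$ if both branches do; $P\bowtie Q$ has $\mathtt{l}:T,\mathtt{r}:S$ if $P$ has $\mathtt{l}:T,\mathtt{r}:T'$ and $Q$ has $\mathtt{l}:\overline{T'},\mathtt{r}:S$. Identity processes: $\mathrm{id}_{\mathtt{end}}=\mathbf{0}$; $\mathrm{id}_{!t.T}=\mathtt{l}?(x:t).\mathtt{r}!x.\mathrm{id}_T$; $\mathrm{id}_{?t.T}=\mathtt{r}?(x:t).\mathtt{l}!x.\mathrm{id}_T$; $\mathrm{id}_{T\oplus S}=\mathtt{l}\triangleright\{\mathtt{r}\triangleleft\mathsf{inl}.\mathrm{id}_T,\ \mathtt{r}\triangleleft\mathsf{inr}.\mathrm{id}_S\}$; $\mathrm{id}_{T+S}=\mathtt{r}\triangleright\{\mathtt{l}\triangleleft\mathsf{inl}.\mathrm{id}_T,\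 \mathtt{l}\triangleleft\mathsf{inr}.\mathrm{id}_S\}$. Symbolic reduction $\rightsquigarrow$ (on processes possibly with free variables) is the least relation containing the following rules, where $A\leftrightsquigarrow B$ means both $A\rightsquigarrow B$ and $B\rightsquigarrow A$, and closed under symbolic contexts $\mathcal{E}::=[\,]\mid\mathsf{c}?(x:t).\mathcal{E}\mid\mathsf{c}!e.\mathcal{E}\mid\mathsf{c}\triangleleft\ell.\mathcal{E}\mid\mathsf{c}\triangleright\{\mathcal{E},Q\}\mid\mathsf{c}\triangleright\{P,\mathcal{E}\}\mid\mathsf{if}\ e\ \mathsf{then}\ P\ \mathsf{else}\ \mathcal{E}\mid\mathsf{if}\ e\ \mathsf{then}\ \mathcal{E}\ \mathsf{else}\ Q$ (if $P\rightsquigarrow Q$ then $\mathcal{E}[P]\rightsquigarrow\mathcal{E}[Q]$): (up) $\mathtt{l}?(x:t).P\bowtie Q\rightsquigarrow\mathtt{l}?(x:t).(P\bowtie Q)$; $P\bowtie\mathtt{r}?(x:t).Q\rightsquigarrow\mathtt{r}?(x:t).(P\bowtie Q)$; $\mathtt{l}!x.P\bowtie Q\rightsquigarrow\mathtt{l}!x.(P\bowtie Q)$; $P\bowtie\mathtt{r}!x.Q\rightsquigarrow\mathtt{r}!x.(P\bowtie Q)$; $\mathtt{l}\triangleright\{P_{\mathsf{inl}},P_{\mathsf{inr}}\}\bowtie Q\rightsquigarrow\mathtt{l}\triangleright\{P_{\mathsf{inl}}\bowtie Q,P_{\mathsf{inr}}\bowtie Q\}$; $P\bowtie\mathtt{r}\triangleright\{Q_{\mathsf{inl}},Q_{\mathsf{inr}}\}\rightsquigarrow\mathtt{r}\triangleright\{P\bowtie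 Q_{\mathsf{inl}},P\bowtie Q_{\mathsf{inr}}\}$; $\mathtt{l}\triangleleft\ell.P\bowtie Q\rightsquigarrow\mathtt{l}\triangleleft\ell.(P\bowtie Q)$; $P\bowtie\mathtt{r}\triangleleft\ell.Q\rightsquigarrow\mathtt{r}\triangleleft\ell.(P\bowtie Q)$; $(\mathsf{if}\ x\ \mathsf{then}\ P_1\ \mathsf{else}\ P_2)\bowtie Q\rightsquigarrow\mathsf{if}\ x\ \mathsf{then}\ (P_1\bowtie Q)\ \mathsf{else}\ (P_2\bowtie Q)$; $P\bowtie(\mathsf{if}\ x\ \mathsf{then}\ Q_1\ \mathsf{else}\ Q_2)\rightsquigarrow\mathsf{if}\ x\ \mathsf{then}\ (P\bowtie Q_1)\ \mathsf{else}\ (P\bowtie Q_2)$. (swap) $\mathsf{c}?(x:t).\bar{\mathsf{c}}?(y:s).P\rightsquigarrow\bar{\mathsf{c}}?(y:s).\mathsf{c}?(x:t).P$; $\mathsf{c}!x.\bar{\mathsf{c}}!y.P\rightsquigarrow\bar{\mathsf{c}}!y.\mathsf{c}!x.P$; $\mathsf{c}?(x:t).\bar{\mathsf{c}}!y.P\leftrightsquigarrow\bar{\mathsf{c}}!y.\mathsf{c}?(x:t).P$ provided $x\neq y$; $\mathsf{c}?(x:t).\bar{\mathsf{c}}\triangleleft\ell.P\leftrightsquigarrow\bar{\mathsf{c}}\triangleleft\ell.\mathsf{c}?(x:t).P$; $\mathsf{c}!x.\bar{\mathsf{c}}\triangleleft\ell.P\leftrightsquigarrow\bar{\mathsf{c}}\triangleleft\ell.\mathsf{c}!x.P$;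 $\mathsf{c}?(x:t).\bar{\mathsf{c}}\triangleright\{P,Q\}\leftrightsquigarrow\bar{\mathsf{c}}\triangleright\{\mathsf{c}?(x:t).P,\mathsf{c}?(x:t).Q\}$; $\mathsf{c}!x.\bar{\mathsf{c}}\triangleright\{P,Q\}\leftrightsquigarrow\bar{\mathsf{c}}\triangleright\{\mathsf{c}!x.P,\mathsf{c}!x.Q\}$; $\mathsf{c}\triangleright\{\bar{\mathsf{c}}\triangleleft\ell.P,\bar{\mathsf{c}}\triangleleft\ell.Q\}\leftrightsquigarrow\bar{\mathsf{c}}\triangleleft\ell.\mathsf{c}\triangleright\{P,Q\}$; $\mathsf{c}\triangleleft\ell.\bar{\mathsf{c}}\triangleleft\ell'.P\leftrightsquigarrow\bar{\mathsf{c}}\triangleleft\ell'.\mathsf{c}\triangleleft\ell.P$; $\mathsf{c}\triangleright\{\bar{\mathsf{c}}\triangleright\{P_1,Q_1\},\bar{\mathsf{c}}\triangleright\{P_2,Q_2\}\}\leftrightsquigarrow\bar{\mathsf{c}}\triangleright\{\mathsf{c}\triangleright\{P_1,P_2\},\mathsf{c}\triangleright\{Q_1,Q_2\}\}$. (cond) $\mathsf{if}\ x\ \mathsf{then}\ \mathsf{c}!\mathsf{true}.P\ \mathsf{else}\ \mathsf{c}!\mathsf{false}.P\rightsquigarrow\mathsf{c}!x.P$. (comm) $\mathtt{r}!y.P\bowtie\mathtt{l}?(x:t).Q\rightsquigarrow P\bowtie Q\{y/x\}$; $\mathtt{r}?(x:t).P\bowtie\mathtt{l}!y.Q\rightsquigarrow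 P\{y/x\}\bowtie Q$; $\mathtt{r}\triangleleft\ell.P\bowtie\mathtt{l}\triangleright\{Q_{\mathsf{inl}},Q_{\mathsf{inr}}\}\rightsquigarrow P\bowtie Q_\ell$; $\mathtt{r}\triangleright\{P_{\mathsf{inl}},P_{\mathsf{inr}}\}\bowtie\mathtt{l}\triangleleft\ell.Q\rightsquigarrow P_\ell\bowtie Q$. (id) $\mathrm{id}_T\bowtie\mathrm{id}_T\rightsquigarrow\mathrm{id}_T$. $\rightsquigarrow^*$ is the reflexive-transitive closure. *)

theory Defs
  imports Main
begin

text \<open>
  Variables are de Bruijn indices, so that terms are processes up to renaming of bound variables.
  The only binder is the input \<open>Inp c t P\<close>, which binds index 0 in \<open>P\<close>.

  Besides \<open>unit\<close>, \<open>bool\<close> and \<open>int\<close> there may be further basic types, with names in \<open>'t\<close>, whose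
  values are drawn from \<open>'v\<close>; the parameter \<open>I :: 't \<Rightarrow> 'v set\<close> used below gives the values of
  each of them.
\<close>

datatype chan = ChL | ChR

primrec co :: "chan \<Rightarrow> chan" where
  "co ChL = ChR"
| "co ChR = ChL"

datatype selector = SInl | SInr

primrec select :: "selector \<Rightarrow> 'a \<Rightarrow> 'a \<Rightarrow> 'a" where
  "select SInl x y = x"
| "select SInr x y = y"

datatype 't btype = TUnit | TBool | TInt | TBasic 't

datatype 'v bval = VUnit | VBool bool | VInt int | VBasic 'v

fun has_btype :: "('t \<Rightarrow> 'v set) \<Rightarrow> 'v bval \<Rightarrow> 't btype \<Rightarrow> bool" where
  "has_btype I VUnit TUnit \<longleftrightarrow> True"
| "has_btype I (VBool b) TBool \<longleftrightarrow> True"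
| "has_btype I (VInt k) TInt \<longleftrightarrow> True"
| "has_btype I (VBasic a) (TBasic u) \<longleftrightarrow> a \<in> I u"
| "has_btype I _ _ \<longleftrightarrow> False"

datatype 'v expr = Var nat | Val "'v bval" | Eq "'v expr" "'v expr"

inductive eval :: "'v expr \<Rightarrow> 'v bval \<Rightarrow> bool" where
  "eval (Val v) v"
| "\<lbrakk>eval e1 v1; eval e2 v2\<rbrakk> \<Longrightarrow> eval (Eq e1 e2) (VBool (v1 = v2))"

datatype ('v, 't) proc =
    Idle
  | Inp chan "'t btype" "('v, 't) proc"
  | Out chan "'v expr" "('v, 't) proc"
  | Sel chan selector "('v, 't) proc"
  | Bra chan "('v, 't) proc" "('v, 't) proc"
  | Cond "'v expr" "('v, 't) proc" "('v, 't) proc"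
  | Par "('v, 't) proc" "('v, 't) proc"  (infixl "\<bowtie>" 60)

primrec fv_expr :: "'v expr \<Rightarrow> nat set" where
  "fv_expr (Var n) = {n}"
| "fv_expr (Val v) = {}"
| "fv_expr (Eq e1 e2) = fv_expr e1 \<union> fv_expr e2"

primrec fv :: "('v, 't) proc \<Rightarrow> nat set" where
  "fv Idle = {}"
| "fv (Inp c t P) = {n. Suc n \<in> fv P}"
| "fv (Out c e P) = fv_expr e \<union> fv P"
| "fv (Sel c l P) = fv P"
| "fv (Bra c P Q) = fv P \<union> fv Q"
| "fv (Cond e P Q) = fv_expr e \<union> fv P \<union> fv Q"
| "fv (P \<bowtie> Q) = fv P \<union> fv Q"

section \<open>Substitution\<close>

primrec subst_expr :: "'v expr \<Rightarrow> (nat \<Rightarrow> 'v expr) \<Rightarrow> 'v expr" where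
  "subst_expr (Var n) \<sigma> = \<sigma> n"
| "subst_expr (Val v) \<sigma> = Val v"
| "subst_expr (Eq e1 e2) \<sigma> = Eq (subst_expr e1 \<sigma>) (subst_expr e2 \<sigma>)"

definition up :: "(nat \<Rightarrow> 'v expr) \<Rightarrow> nat \<Rightarrow> 'v expr" where
  "up \<sigma> = case_nat (Var 0) (\<lambda>n. subst_expr (\<sigma> n) (\<lambda>m. Var (Suc m)))"

primrec subst :: "('v, 't) proc \<Rightarrow> (nat \<Rightarrow> 'v expr) \<Rightarrow> ('v, 't) proc" where
  "subst Idle \<sigma> = Idle"
| "subst (Inp c t P) \<sigma> = Inp c t (subst P (up \<sigma>))"
| "subst (Out c e P) \<sigma> = Out c (subst_expr e \<sigma>) (subst P \<sigma>)"
| "subst (Sel c l P) \<sigma> = Sel c l (subst P \<sigma>)"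
| "subst (Bra c P Q) \<sigma> = Bra c (subst P \<sigma>) (subst Q \<sigma>)"
| "subst (Cond e P Q) \<sigma> = Cond (subst_expr e \<sigma>) (subst P \<sigma>) (subst Q \<sigma>)"
| "subst (P \<bowtie> Q) \<sigma> = subst P \<sigma> \<bowtie> subst Q \<sigma>"

text \<open>\<open>inst P e\<close> is usually written \<open>P{e/x}\<close>, for \<open>x\<close> the variable bound by the input in front
  of \<open>P\<close>.\<close>

definition inst :: "('v, 't) proc \<Rightarrow> 'v expr \<Rightarrow> ('v, 't) proc" where
  "inst P e = subst P (case_nat e Var)"

text \<open>\<open>shift P\<close> is the process \<open>P\<close> moved under an input whose variable is not free in it.\<close>

definition shift :: "('v, 't) proc \<Rightarrow> ('v, 't) proc" where
  "shift P = subst P (\<lambda>n. Var (Suc n))"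

text \<open>\<open>exchange P\<close> accounts for swapping the two innermost binders in front of \<open>P\<close>.\<close>

definition exchange :: "('v, 't) proc \<Rightarrow> ('v, 't) proc" where
  "exchange P = subst P (Var(0 := Var 1, 1 := Var 0))"

section \<open>Structural congruence, reduction, equivalence\<close>

inductive scong :: "('v, 't) proc \<Rightarrow> ('v, 't) proc \<Rightarrow> bool"  (infix "\<equiv>\<^sub>s" 50) where
  sc_nil: "Idle \<bowtie> Idle \<equiv>\<^sub>s Idle"
| sc_assoc: "(P \<bowtie> Q) \<bowtie> R \<equiv>\<^sub>s P \<bowtie> (Q \<bowtie> R)"
| sc_refl: "P \<equiv>\<^sub>s P"
| sc_sym: "P \<equiv>\<^sub>s Q \<Longrightarrow> Q \<equiv>\<^sub>s P"
| sc_trans: "\<lbrakk>P \<equiv>\<^sub>s Q; Q \<equiv>\<^sub>s R\<rbrakk> \<Longrightarrow> P \<equiv>\<^sub>s R"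
| sc_inp: "P \<equiv>\<^sub>s Q \<Longrightarrow> Inp c t P \<equiv>\<^sub>s Inp c t Q"
| sc_out: "P \<equiv>\<^sub>s Q \<Longrightarrow> Out c e P \<equiv>\<^sub>s Out c e Q"
| sc_sel: "P \<equiv>\<^sub>s Q \<Longrightarrow> Sel c l P \<equiv>\<^sub>s Sel c l Q"
| sc_bra: "\<lbrakk>P \<equiv>\<^sub>s P'; Q \<equiv>\<^sub>s Q'\<rbrakk> \<Longrightarrow> Bra c P Q \<equiv>\<^sub>s Bra c P' Q'"
| sc_cond: "\<lbrakk>P \<equiv>\<^sub>s P'; Q \<equiv>\<^sub>s Q'\<rbrakk> \<Longrightarrow> Cond e P Q \<equiv>\<^sub>s Cond e P' Q'"
| sc_par: "\<lbrakk>P \<equiv>\<^sub>s P'; Q \<equiv>\<^sub>s Q'\<rbrakk> \<Longrightarrow> P \<bowtie> Q \<equiv>\<^sub>s P' \<bowtie> Q'"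

datatype ('v, 't) rctx =
    RHole
  | RParL "('v, 't) rctx" "('v, 't) proc"
  | RParR "('v, 't) proc" "('v, 't) rctx"

primrec rplug :: "('v, 't) rctx \<Rightarrow> ('v, 't) proc \<Rightarrow> ('v, 't) proc" where
  "rplug RHole P = P"
| "rplug (RParL C Q) P = rplug C P \<bowtie> Q"
| "rplug (RParR Q C) P = Q \<bowtie> rplug C P"

inductive red :: "('t \<Rightarrow> 'v set) \<Rightarrow> ('v, 't) proc \<Rightarrow> ('v, 't) proc \<Rightarrow> bool"
  for I :: "'t \<Rightarrow> 'v set" where
  red_comm_r: "\<lbrakk>eval e v; has_btype I v t\<rbrakk>
    \<Longrightarrow> red I (Out ChR e P \<bowtie> Inp ChL t Q) (P \<bowtie> inst Q (Val v))"
| red_comm_l: "\<lbrakk>eval e v; has_btype I v t\<rbrakk>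
    \<Longrightarrow> red I (Inp ChR t P \<bowtie> Out ChL e Q) (inst P (Val v) \<bowtie> Q)"
| red_sel_r: "red I (Sel ChR l P \<bowtie> Bra ChL Q1 Q2) (P \<bowtie> select l Q1 Q2)"
| red_sel_l: "red I (Bra ChR P1 P2 \<bowtie> Sel ChL l Q) (select l P1 P2 \<bowtie> Q)"
| red_cond: "eval e (VBool b) \<Longrightarrow> red I (Cond e P Q) (if b then P else Q)"
| red_ctx: "red I P Q \<Longrightarrow> red I (rplug C P) (rplug C Q)"
| red_struct: "\<lbrakk>P \<equiv>\<^sub>s P'; red I P' Q'; Q' \<equiv>\<^sub>s Q\<rbrakk> \<Longrightarrow> red I P Q"

definition correct :: "('t \<Rightarrow> 'v set) \<Rightarrow> ('v, 't) proc \<Rightarrow> bool" where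
  "correct I P \<longleftrightarrow> (\<forall>Q. (red I)\<^sup>*\<^sup>* P Q \<and> (\<nexists>Q'. red I Q Q') \<longrightarrow> Q \<equiv>\<^sub>s Idle)"

definition equivalent :: "('t \<Rightarrow> 'v set) \<Rightarrow> ('v, 't) proc \<Rightarrow> ('v, 't) proc \<Rightarrow> bool" where
  "equivalent I P Q \<longleftrightarrow> (\<forall>C. correct I (rplug C P) \<longleftrightarrow> correct I (rplug C Q))"

section \<open>Session types\<close>

datatype 't stype =
    End
  | Recv "'t btype" "'t stype"
  | Send "'t btype" "'t stype"
  | Branch "'t stype" "'t stype"
  | Choice "'t stype" "'t stype"

primrec dual :: "'t stype \<Rightarrow> 't stype" where
  "dual End = End"
| "dual (Recv t T) = Send t (dual T)"
| "dual (Send t T) = Recv t (dual T)"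
| "dual (Branch T S) = Choice (dual T) (dual S)"
| "dual (Choice T S) = Branch (dual T) (dual S)"

inductive expr_typed :: "('t \<Rightarrow> 'v set) \<Rightarrow> 't btype list \<Rightarrow> 'v expr \<Rightarrow> 't btype \<Rightarrow> bool"
  for I :: "'t \<Rightarrow> 'v set" and \<Gamma> :: "'t btype list" where
  et_var: "n < length \<Gamma> \<Longrightarrow> expr_typed I \<Gamma> (Var n) (\<Gamma> ! n)"
| et_val: "has_btype I v t \<Longrightarrow> expr_typed I \<Gamma> (Val v) t"
| et_eq: "\<lbrakk>expr_typed I \<Gamma> e1 t; expr_typed I \<Gamma> e2 t\<rbrakk> \<Longrightarrow> expr_typed I \<Gamma> (Eq e1 e2) TBool"

text \<open>\<open>sess c T S\<close> is the unordered pair of associations \<open>c : T, co c : S\<close>, so that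
  \<open>sess ChL T S = sess ChR S T\<close>.\<close>

definition sess :: "chan \<Rightarrow> 't stype \<Rightarrow> 't stype \<Rightarrow> chan \<Rightarrow> 't stype" where
  "sess c T S = (\<lambda>d. if d = c then T else S)"

inductive typed ::
    "('t \<Rightarrow> 'v set) \<Rightarrow> 't btype list \<Rightarrow> ('v, 't) proc \<Rightarrow> (chan \<Rightarrow> 't stype) \<Rightarrow> bool"
  for I :: "'t \<Rightarrow> 'v set" where
  ty_nil: "typed I \<Gamma> Idle (sess ChL End End)"
| ty_inp: "typed I (t # \<Gamma>) P (sess c T S) \<Longrightarrow> typed I \<Gamma> (Inp c t P) (sess c (Recv t T) S)"
| ty_out: "\<lbrakk>expr_typed I \<Gamma> e t; typed I \<Gamma> P (sess c T S)\<rbrakk>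
    \<Longrightarrow> typed I \<Gamma> (Out c e P) (sess c (Send t T) S)"
| ty_bra: "\<lbrakk>typed I \<Gamma> P1 (sess c T1 S); typed I \<Gamma> P2 (sess c T2 S)\<rbrakk>
    \<Longrightarrow> typed I \<Gamma> (Bra c P1 P2) (sess c (Branch T1 T2) S)"
| ty_inl: "typed I \<Gamma> P (sess c T1 S) \<Longrightarrow> typed I \<Gamma> (Sel c SInl P) (sess c (Choice T1 T2) S)"
| ty_inr: "typed I \<Gamma> P (sess c T2 S) \<Longrightarrow> typed I \<Gamma> (Sel c SInr P) (sess c (Choice T1 T2) S)"
| ty_cond: "\<lbrakk>expr_typed I \<Gamma> e TBool; typed I \<Gamma> P (sess ChL T S); typed I \<Gamma> Q (sess ChL T S)\<rbrakk>
    \<Longrightarrow> typed I \<Gamma> (Cond e P Q) (sess ChL T S)"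
| ty_par: "\<lbrakk>typed I \<Gamma> P (sess ChL T T'); typed I \<Gamma> Q (sess ChL (dual T') S)\<rbrakk>
    \<Longrightarrow> typed I \<Gamma> (P \<bowtie> Q) (sess ChL T S)"

section \<open>Symbolic reduction\<close>

primrec id_proc :: "'t stype \<Rightarrow> ('v, 't) proc" where
  "id_proc End = Idle"
| "id_proc (Send t T) = Inp ChL t (Out ChR (Var 0) (id_proc T))"
| "id_proc (Recv t T) = Inp ChR t (Out ChL (Var 0) (id_proc T))"
| "id_proc (Choice T S) = Bra ChL (Sel ChR SInl (id_proc T)) (Sel ChR SInr (id_proc S))"
| "id_proc (Branch T S) = Bra ChR (Sel ChL SInl (id_proc T)) (Sel ChL SInr (id_proc S))"

datatype ('v, 't) sctx =
    SHole
  | SInp chan "'t btype" "('v, 't) sctx"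
  | SOut chan "'v expr" "('v, 't) sctx"
  | SSel chan selector "('v, 't) sctx"
  | SBraL chan "('v, 't) sctx" "('v, 't) proc"
  | SBraR chan "('v, 't) proc" "('v, 't) sctx"
  | SCondL "'v expr" "('v, 't) sctx" "('v, 't) proc"
  | SCondR "'v expr" "('v, 't) proc" "('v, 't) sctx"

primrec splug :: "('v, 't) sctx \<Rightarrow> ('v, 't) proc \<Rightarrow> ('v, 't) proc" where
  "splug SHole P = P"
| "splug (SInp c t E) P = Inp c t (splug E P)"
| "splug (SOut c e E) P = Out c e (splug E P)"
| "splug (SSel c l E) P = Sel c l (splug E P)"
| "splug (SBraL c E Q) P = Bra c (splug E P) Q"
| "splug (SBraR c Q E) P = Bra c Q (splug E P)"
| "splug (SCondL e E Q) P = Cond e (splug E P) Q"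
| "splug (SCondR e Q E) P = Cond e Q (splug E P)"

inductive symred :: "('v, 't) proc \<Rightarrow> ('v, 't) proc \<Rightarrow> bool"  (infix "\<leadsto>" 50) where
  up_inp_l: "Inp ChL t P \<bowtie> Q \<leadsto> Inp ChL t (P \<bowtie> shift Q)"
| up_inp_r: "P \<bowtie> Inp ChR t Q \<leadsto> Inp ChR t (shift P \<bowtie> Q)"
| up_out_l: "Out ChL (Var x) P \<bowtie> Q \<leadsto> Out ChL (Var x) (P \<bowtie> Q)"
| up_out_r: "P \<bowtie> Out ChR (Var x) Q \<leadsto> Out ChR (Var x) (P \<bowtie> Q)"
| up_bra_l: "Bra ChL P1 P2 \<bowtie> Q \<leadsto> Bra ChL (P1 \<bowtie> Q) (P2 \<bowtie> Q)"
| up_bra_r: "P \<bowtie> Bra ChR Q1 Q2 \<leadsto> Bra ChR (P \<bowtie> Q1) (P \<bowtie> Q2)"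
| up_sel_l: "Sel ChL l P \<bowtie> Q \<leadsto> Sel ChL l (P \<bowtie> Q)"
| up_sel_r: "P \<bowtie> Sel ChR l Q \<leadsto> Sel ChR l (P \<bowtie> Q)"
| up_cond_l: "Cond (Var x) P1 P2 \<bowtie> Q \<leadsto> Cond (Var x) (P1 \<bowtie> Q) (P2 \<bowtie> Q)"
| up_cond_r: "P \<bowtie> Cond (Var x) Q1 Q2 \<leadsto> Cond (Var x) (P \<bowtie> Q1) (P \<bowtie> Q2)"

| swap_inp_inp: "Inp c t (Inp (co c) s P) \<leadsto> Inp (co c) s (Inp c t (exchange P))"
| swap_out_out: "Out c (Var x) (Out (co c) (Var y) P) \<leadsto> Out (co c) (Var y) (Out c (Var x) P)"
  \<comment> \<open>\<open>Suc y\<close> is the outer variable \<open>y\<close> seen from under the input; it differs from the bound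
    variable 0, which is the proviso of the two rules.\<close>
| swap_inp_out: "Inp c t (Out (co c) (Var (Suc y)) P) \<leadsto> Out (co c) (Var y) (Inp c t P)"
| swap_out_inp: "Out (co c) (Var y) (Inp c t P) \<leadsto> Inp c t (Out (co c) (Var (Suc y)) P)"
| swap_inp_sel: "Inp c t (Sel (co c) l P) \<leadsto> Sel (co c) l (Inp c t P)"
| swap_sel_inp: "Sel (co c) l (Inp c t P) \<leadsto> Inp c t (Sel (co c) l P)"
| swap_out_sel: "Out c (Var x) (Sel (co c) l P) \<leadsto> Sel (co c) l (Out c (Var x) P)"
| swap_sel_out: "Sel (co c) l (Out c (Var x) P) \<leadsto> Out c (Var x) (Sel (co c) l P)"
| swap_inp_bra: "Inp c t (Bra (co c) P Q) \<leadsto> Bra (co c) (Inp c t P) (Inp c t Q)"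
| swap_bra_inp: "Bra (co c) (Inp c t P) (Inp c t Q) \<leadsto> Inp c t (Bra (co c) P Q)"
| swap_out_bra:
    "Out c (Var x) (Bra (co c) P Q) \<leadsto> Bra (co c) (Out c (Var x) P) (Out c (Var x) Q)"
| swap_bra_out:
    "Bra (co c) (Out c (Var x) P) (Out c (Var x) Q) \<leadsto> Out c (Var x) (Bra (co c) P Q)"
| swap_bra_sel: "Bra c (Sel (co c) l P) (Sel (co c) l Q) \<leadsto> Sel (co c) l (Bra c P Q)"
| swap_sel_bra: "Sel (co c) l (Bra c P Q) \<leadsto> Bra c (Sel (co c) l P) (Sel (co c) l Q)"
| swap_sel_sel: "Sel c l (Sel (co c) l' P) \<leadsto> Sel (co c) l' (Sel c l P)"
| swap_sel_sel': "Sel (co c) l' (Sel c l P) \<leadsto> Sel c l (Sel (co c) l' P)"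
| swap_bra_bra: "Bra c (Bra (co c) P1 Q1) (Bra (co c) P2 Q2)
    \<leadsto> Bra (co c) (Bra c P1 P2) (Bra c Q1 Q2)"
| swap_bra_bra': "Bra (co c) (Bra c P1 P2) (Bra c Q1 Q2)
    \<leadsto> Bra c (Bra (co c) P1 Q1) (Bra (co c) P2 Q2)"

| cond: "Cond (Var x) (Out c (Val (VBool True)) P) (Out c (Val (VBool False)) P) \<leadsto> Out c (Var x) P"

| comm_r: "Out ChR (Var y) P \<bowtie> Inp ChL t Q \<leadsto> P \<bowtie> inst Q (Var y)"
| comm_l: "Inp ChR t P \<bowtie> Out ChL (Var y) Q \<leadsto> inst P (Var y) \<bowtie> Q"
| comm_sel_r: "Sel ChR l P \<bowtie> Bra ChL Q1 Q2 \<leadsto> P \<bowtie> select l Q1 Q2"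
| comm_sel_l: "Bra ChR P1 P2 \<bowtie> Sel ChL l Q \<leadsto> select l P1 P2 \<bowtie> Q"

| ident: "id_proc T \<bowtie> id_proc T \<leadsto> id_proc T"

| ctx: "P \<leadsto> Q \<Longrightarrow> splug E P \<leadsto> splug E Q"

end

theory Submission
  imports Defs
begin

text \<open>
  Up to structural congruence a process is a linear pipeline of sequential processes, each of
  which is idle, a conditional, or a prefix on exactly one of its two channels. Hence distinct
  redexes never overlap and reduction has the diamond property; since it also terminates, a
  process is correct iff it can reach \<open>Idle\<close>. The two sides of a prefix run independently of each
  other, so in any successful run the communication of a given prefix can be brought forward to
  the moment its partner is ready. Therefore, whatever surrounds it, success depends on a prefix
  only through its residuals, and two adjacent prefixes on opposite channels may be performed in
  either order: this yields the \<open>up\<close> and \<open>swap\<close> rules. The rule \<open>ident\<close> follows from the other rules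
  and \<open>Idle \<bowtie> Idle \<equiv>\<^sub>s Idle\<close> by induction on the session type. Typing is preserved by symbolic
  reduction and guarantees that the values substituted for the variables of an open process
  belong to the types expected by the \<open>comm\<close> and \<open>cond\<close> rules.
\<close>

section \<open>Pipelines\<close>

datatype 'v label = LIn "'v bval" | LOut "'v bval" | LSel selector | LBra selector

primrec colabel :: "'v label \<Rightarrow> 'v label" where
  "colabel (LIn v) = LOut v"
| "colabel (LOut v) = LIn v"
| "colabel (LSel l) = LBra l"
| "colabel (LBra l) = LSel l"

lemma colabel_colabel [simp]: "colabel (colabel a) = a"
  by (cases a) auto

text \<open>Early style: an input has one transition for each value of its type, and a branching one
  for each selector. An ill-typed message then shows up simply as the absence of a complementary
  label.\<close>

inductive act :: "('t \<Rightarrow> 'v set) \<Rightarrow> ('v, 't) proc \<Rightarrow> chan \<Rightarrow> 'v label \<Rightarrow> ('v, 't) proc \<Rightarrow> bool"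
  for I :: "'t \<Rightarrow> 'v set" where
  act_inp: "has_btype I v t \<Longrightarrow> act I (Inp c t P) c (LIn v) (inst P (Val v))"
| act_out: "eval e v \<Longrightarrow> act I (Out c e P) c (LOut v) P"
| act_sel: "act I (Sel c l P) c (LSel l) P"
| act_bra: "act I (Bra c P Q) c (LBra l) (select l P Q)"

lemma act_iff [simp]:
  "\<not> act I Idle d a X"
  "\<not> act I (Cond e P Q) d a X"
  "\<not> act I (P \<bowtie> Q) d a X"
  "act I (Inp c t P) d a X \<longleftrightarrow> (\<exists>v. has_btype I v t \<and> d = c \<and> a = LIn v \<and> X = inst P (Val v))"
  "act I (Out c e P) d a X \<longleftrightarrow> (\<exists>v. eval e v \<and> d = c \<and> a = LOut v \<and> X = P)"
  "act I (Sel c l P) d a X \<longleftrightarrow> d = c \<and> a = LSel l \<and> X = P"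
  "act I (Bra c P Q) d a X \<longleftrightarrow> (\<exists>l. d = c \<and> a = LBra l \<and> X = select l P Q)"
  by (auto elim: act.cases intro: act.intros)

text \<open>Unfolding a parallel composition counts as a step, whence the list on the right.
  Pipelines can thus be plain lists, with no quotient by associativity.\<close>

inductive tau :: "('v, 't) proc \<Rightarrow> ('v, 't) proc list \<Rightarrow> bool" where
  tau_par: "tau (P \<bowtie> Q) [P, Q]"
| tau_cond: "eval e (VBool b) \<Longrightarrow> tau (Cond e P Q) [if b then P else Q]"

primrec subj :: "('v, 't) proc \<Rightarrow> chan option" where
  "subj Idle = None"
| "subj (Inp c t P) = Some c"
| "subj (Out c e P) = Some c"
| "subj (Sel c l P) = Some c"
| "subj (Bra c P Q) = Some c"
| "subj (Cond e P Q) = None"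
| "subj (P \<bowtie> Q) = None"

lemma subj_act: "act I A c a A' \<Longrightarrow> subj A = Some c"
  by (auto elim: act.cases)

lemma subj_tau: "tau A X \<Longrightarrow> subj A = None"
  by (auto elim: tau.cases)

lemma eval_det: "eval e v \<Longrightarrow> eval e w \<Longrightarrow> v = w"
proof (induction arbitrary: w rule: eval.induct)
  case (1 v)
  then show ?case by (auto elim: eval.cases)
next
  case (2 e1 v1 e2 v2)
  from \<open>eval (Eq e1 e2) w\<close> show ?case
    by (cases rule: eval.cases) (use 2 in auto)
qed

lemma eval_Val [simp]: "eval (Val v) w \<longleftrightarrow> w = v"
  by (auto elim: eval.cases intro: eval.intros)

lemma tau_det: "tau A X \<Longrightarrow> tau A Y \<Longrightarrow> X = Y"
  by (auto elim!: tau.cases dest: eval_det)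

lemma act_det: "act I A c a X \<Longrightarrow> act I A c a Y \<Longrightarrow> X = Y"
  by (cases A) auto

text \<open>One of the two partners sends or selects, and that partner alone fixes the label, since
  evaluation is deterministic.\<close>

lemma comm_label_det:
  assumes "act I A c a A'" "act I B d (colabel a) B'" "act I A c b A''" "act I B d (colabel b) B''"
  shows "a = b"
  using assms by (cases A; cases B) (auto dest: eval_det)

section \<open>Steps of pipelines and their confluence\<close>

inductive step :: "('t \<Rightarrow> 'v set) \<Rightarrow> ('v, 't) proc list \<Rightarrow> ('v, 't) proc list \<Rightarrow> bool"
  for I :: "'t \<Rightarrow> 'v set" where
  step_tau: "tau A X \<Longrightarrow> step I (xs @ A # ys) (xs @ X @ ys)"
| step_comm: "\<lbrakk>act I A ChR a A'; act I B ChL (colabel a) B'\<rbrakk>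
    \<Longrightarrow> step I (xs @ A # B # ys) (xs @ A' # B' # ys)"

lemma step_append: "step I xs ys \<Longrightarrow> step I (pre @ xs @ post) (pre @ ys @ post)"
proof (induction rule: step.induct)
  case (step_tau A X xs ys)
  then show ?case using step.step_tau[of A X I "pre @ xs" "ys @ post"] by simp
next
  case (step_comm A a A' B B' xs ys)
  then show ?case using step.step_comm[of I A a A' B B' "pre @ xs" "ys @ post"] by simp
qed

lemma step_appendL: "step I xs ys \<Longrightarrow> step I (xs @ post) (ys @ post)"
  using step_append[of I xs ys "[]" post] by simp

lemma step_appendR: "step I xs ys \<Longrightarrow> step I (pre @ xs) (pre @ ys)"
  using step_append[of I xs ys pre "[]"] by simp

lemma steps_append: "(step I)\<^sup>*\<^sup>* xs ys \<Longrightarrow> (step I)\<^sup>*\<^sup>* (pre @ xs @ post) (pre @ ys @ post)"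
  by (induction rule: rtranclp_induct) (auto intro: step_append rtranclp.rtrancl_into_rtrancl)

lemma step_Nil [simp]: "\<not> step I [] ys"
  by (auto elim: step.cases)

text \<open>Locates a step relative to one marked element, so that inductions on runs can follow
  that element. In both communication cases \<open>a\<close> is the label of the partner acting on
  \<open>ChR\<close>.\<close>

lemma step_cases [consumes 1, case_names left right tau comm_left comm_right]:
  assumes "step I (pre @ A # post) ys"
  obtains
    (left) pre' where "step I pre pre'" "ys = pre' @ A # post"
  | (right) post' where "step I post post'" "ys = pre @ A # post'"
  | (tau) X where "tau A X" "ys = pre @ X @ post"
  | (comm_left) pre' B B' A' a where "pre = pre' @ [B]" "act I B ChR a B'"
      "act I A ChL (colabel a) A'" "ys = pre' @ B' # A' # post"
  | (comm_right) post' B B' A' a where "post = B # post'" "act I B ChL (colabel a) B'"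
      "act I A ChR a A'" "ys = pre @ A' # B' # post'"
  using assms
proof (cases rule: step.cases)
  case (step_tau P X xs zs)
  from step_tau(1) consider
    us where "pre = xs @ P # us" "zs = us @ A # post" | "pre = xs" "P = A" "zs = post"
    | us where "xs = pre @ A # us" "post = us @ P # zs"
    by (auto simp: append_eq_append_conv2 Cons_eq_append_conv append_eq_Cons_conv)
  then show thesis
  proof cases
    case (1 us)
    then show thesis using step_tau step.step_tau[of P X I xs us] by (intro left) auto
  next
    case 2
    then show thesis using step_tau tau by blast
  next
    case (3 us)
    then show thesis using step_tau step.step_tau[of P X I us zs] by (intro right) auto
  qed
next
  case (step_comm P a P' Q Q' xs zs)
  from step_comm(1) consider
    us where "pre = xs @ P # Q # us" "zs = us @ A # post"
    | "pre = xs @ [P]" "Q = A" "zs = post"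
    | "pre = xs" "P = A" "post = Q # zs"
    | us where "xs = pre @ A # us" "post = us @ P # Q # zs"
    by (auto simp: append_eq_append_conv2 Cons_eq_append_conv append_eq_Cons_conv)
  then show thesis
  proof cases
    case (1 us)
    then show thesis using step_comm step.step_comm[of I P a P' Q Q' xs us] by (intro left) auto
  next
    case 2
    then show thesis using step_comm comm_left by blast
  next
    case 3
    then show thesis using step_comm comm_right by blast
  next
    case (4 us)
    then show thesis using step_comm step.step_comm[of I P a P' Q Q' us zs] by (intro right) auto
  qed
qed

text \<open>Two steps that share an element must be the same step: the element has a single subject,
  or none, and its partner is the neighbour on that side. Steps without a common element
  commute.\<close>

lemma step_diamond:
  assumes "step I xs ys" "step I xs zs"
  shows "ys = zs \<or> (\<exists>us. step I ys us \<and> step I zs us)"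
  using assms(1)
proof (cases rule: step.cases)
  case (step_tau A X pre post)
  have "step I (pre @ A # post) zs" using assms(2) step_tau by simp
  then show ?thesis
  proof (cases rule: step_cases)
    case (left pre')
    then show ?thesis using step_tau step_appendL[of I pre pre' "X @ post"]
      step.step_tau[of A X I pre' post] by auto
  next
    case (right post')
    then show ?thesis using step_tau step_appendR[of I post post' "pre @ X"]
      step.step_tau[of A X I pre post'] by auto
  next
    case (tau Y)
    then show ?thesis using step_tau tau_det by blast
  qed (use step_tau subj_tau subj_act in \<open>metis option.distinct(1)\<close>)+
next
  case (step_comm A a A' B B' pre post)
  have sA: "subj A = Some ChR" and sB: "subj B = Some ChL"
    using step_comm subj_act by blast+
  have "step I (pre @ A # (B # post)) zs" using assms(2) step_comm by simp
  then show ?thesis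
  proof (cases rule: step_cases)
    case (left pre')
    then show ?thesis using step_comm step_appendL[of I pre pre' "A' # B' # post"]
      step.step_comm[of I A a A' B B' pre' post] by auto
  next
    case (right rest)
    \<comment> \<open>A step to the right of \<open>A\<close> may still involve \<open>B\<close>, so
      it is located again with \<open>B\<close> as the marked element.\<close>
    then have "step I ([] @ B # post) rest" by simp
    then show ?thesis
    proof (cases rule: step_cases)
      case (right post')
      then show ?thesis using step_comm \<open>zs = pre @ A # rest\<close>
          step_appendR[of I post post' "pre @ [A', B']"]
          step.step_comm[of I A a A' B B' pre post'] by auto
    next
      case (tau X)
      then show ?thesis using sB subj_tau by fastforce
    next
      case comm_right
      then show ?thesis using sB subj_act by fastforce
    qed auto
  next
    case (tau Y)
    then show ?thesis using sA subj_tau by fastforce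
  next
    case comm_left
    then show ?thesis using sA subj_act by fastforce
  next
    case (comm_right post' C C' A'' b)
    then have "C = B" "post' = post" by auto
    with comm_right step_comm have "a = b" using comm_label_det by metis
    with comm_right step_comm \<open>C = B\<close> \<open>post' = post\<close> show ?thesis by (metis act_det)
  qed
qed

section \<open>Successful pipelines\<close>

text \<open>One successful run is enough here: by the diamond property success is invariant under
  steps in both directions, as \<open>ok_step\<close> records. The empty pipeline counts as
  successful.\<close>

definition ok :: "('t \<Rightarrow> 'v set) \<Rightarrow> ('v, 't) proc list \<Rightarrow> bool" where
  "ok I xs \<longleftrightarrow> (\<exists>ys. (step I)\<^sup>*\<^sup>* xs ys \<and> set ys \<subseteq> {Idle})"

lemma step_not_all_Idle: "step I xs ys \<Longrightarrow> \<not> set xs \<subseteq> {Idle}"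
  by (auto elim!: step.cases tau.cases)

lemma ok_Idles: "set xs \<subseteq> {Idle} \<Longrightarrow> ok I xs"
  unfolding ok_def by blast

lemma ok_steps: "(step I)\<^sup>*\<^sup>* xs ys \<Longrightarrow> ok I ys \<Longrightarrow> ok I xs"
  unfolding ok_def by (meson rtranclp_trans)

lemma ok_induct [consumes 1, case_names Idles step]:
  assumes "ok I xs"
    and "\<And>xs. set xs \<subseteq> {Idle} \<Longrightarrow> H xs"
    and "\<And>xs ys. \<lbrakk>step I xs ys; ok I ys; H ys\<rbrakk> \<Longrightarrow> H xs"
  shows "H xs"
proof -
  obtain zs where "(step I)\<^sup>*\<^sup>* xs zs" and zs: "set zs \<subseteq> {Idle}" using assms(1) ok_def by blast
  then show ?thesis
    by (induction rule: converse_rtranclp_induct) (use assms(2,3) zs ok_def in \<open>blast+\<close>)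
qed

text \<open>Induction along the successful run: the diamond carries the given step past the first
  step of the run, and an all-idle pipeline has no step.\<close>

lemma ok_step_forward: "ok I xs \<Longrightarrow> step I xs ys \<Longrightarrow> ok I ys"
proof (induction arbitrary: ys rule: ok_induct)
  case (Idles xs)
  then show ?case using step_not_all_Idle by blast
next
  case (step xs xs')
  then show ?case using step_diamond[OF step(1) step(4)] ok_steps by blast
qed

lemma ok_step: "step I xs ys \<Longrightarrow> ok I xs \<longleftrightarrow> ok I ys"
  using ok_step_forward ok_steps by blast

text \<open>An idle element takes part in no step, so it cuts every run into two independent
  ones.\<close>

lemma ok_Idle: "ok I (pre @ Idle # post) \<longleftrightarrow> ok I pre \<and> ok I post"
proof
  assume "ok I (pre @ Idle # post)"
  then show "ok I pre \<and> ok I post"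
  proof (induction "pre @ Idle # post" arbitrary: pre post rule: ok_induct)
    case Idles
    then show ?case by (simp add: ok_Idles)
  next
    case (step ys)
    from step(1) show ?case
    proof (cases rule: step_cases)
      case (left pre')
      then show ?thesis using step(3)[of pre' post] ok_step by blast
    next
      case (right post')
      then show ?thesis using step(3)[of pre post'] ok_step by blast
    qed (auto elim: tau.cases)
  qed
next
  assume a: "ok I pre \<and> ok I post"
  then obtain xs ys where xy: "(step I)\<^sup>*\<^sup>* pre xs" "set xs \<subseteq> {Idle}"
    "(step I)\<^sup>*\<^sup>* post ys" "set ys \<subseteq> {Idle}" unfolding ok_def by blast
  then have "(step I)\<^sup>*\<^sup>* (pre @ Idle # post) (xs @ Idle # ys)"
    using steps_append[of I pre xs "[]" "Idle # post"] steps_append[of I post ys "xs @ [Idle]" "[]"]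
    by simp
  moreover have "ok I (xs @ Idle # ys)" using xy by (intro ok_Idles) auto
  ultimately show "ok I (pre @ Idle # post)" by (rule ok_steps)
qed

text \<open>A conditional can leave the pipeline only through its own \<open>tau\<close> step, so a
  stuck guard rules out success.\<close>

lemma ok_Cond_evaluates: "ok I (pre @ Cond e P Q # post) \<Longrightarrow> \<exists>b. eval e (VBool b)"
proof (induction "pre @ Cond e P Q # post" arbitrary: pre post rule: ok_induct)
  case (step ys)
  from step(1) show ?case
    by (cases rule: step_cases) (use step(3) in \<open>auto elim: tau.cases\<close>)
qed simp

text \<open>A prefix never blocks the parts of the pipeline on its two sides, so in a successful run
  its communication can be scheduled as soon as its partner is ready.\<close>

lemma ok_left_prefix:
  assumes "subj A = Some ChL"
  shows "ok I (pre @ A # post) \<longleftrightarrow>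
    (\<exists>pre' B B' a A'. (step I)\<^sup>*\<^sup>* pre (pre' @ [B]) \<and> act I B ChR a B' \<and> act I A ChL (colabel a) A' \<and>
      ok I (pre' @ B' # A' # post))" (is "_ \<longleftrightarrow> ?R pre post")
proof
  assume "ok I (pre @ A # post)"
  then show "?R pre post"
  proof (induction "pre @ A # post" arbitrary: pre post rule: ok_induct)
    case Idles
    then show ?case using assms by auto
  next
    case (step ys)
    from step(1) show ?case
    proof (cases rule: step_cases)
      case (left pre')
      then show ?thesis using step(3)[of pre' post] by (meson converse_rtranclp_into_rtranclp)
    next
      case (right post')
      then obtain pre' B B' a A' where *: "(step I)\<^sup>*\<^sup>* pre (pre' @ [B])" "act I B ChR a B'"
        "act I A ChL (colabel a) A'" "ok I (pre' @ B' # A' # post')"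
        using step(3)[of pre post'] by blast
      \<comment> \<open>The step inside \<open>post\<close> is postponed until after the
        communication of \<open>A\<close>.\<close>
      then have "ok I (pre' @ B' # A' # post)"
        using ok_step step_appendR[OF right(1), of "pre' @ [B', A']"] by fastforce
      then show ?thesis using * by blast
    next
      case (tau X)
      then show ?thesis using assms subj_tau by fastforce
    next
      case (comm_left pre' B B' A' a)
      then show ?thesis using step(2) by blast
    next
      case comm_right
      then show ?thesis using assms subj_act by fastforce
    qed
  qed
next
  assume "?R pre post"
  then obtain pre' B B' a A' where *: "(step I)\<^sup>*\<^sup>* pre (pre' @ [B])" "act I B ChR a B'"
        "act I A ChL (colabel a) A'" "ok I (pre' @ B' # A' # post)" by blast
  then have "ok I (pre' @ B # A # post)" using step_comm ok_step by blast
  then show "ok I (pre @ A # post)"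
    using ok_steps steps_append[OF *(1), of "[]" "A # post"] by simp
qed

lemma ok_right_prefix:
  assumes "subj A = Some ChR"
  shows "ok I (pre @ A # post) \<longleftrightarrow>
    (\<exists>post' B B' a A'. (step I)\<^sup>*\<^sup>* post (B # post') \<and> act I B ChL a B' \<and> act I A ChR (colabel a) A' \<and>
      ok I (pre @ A' # B' # post'))" (is "_ \<longleftrightarrow> ?R pre post")
proof
  assume "ok I (pre @ A # post)"
  then show "?R pre post"
  proof (induction "pre @ A # post" arbitrary: pre post rule: ok_induct)
    case Idles
    then show ?case using assms by auto
  next
    case (step ys)
    from step(1) show ?case
    proof (cases rule: step_cases)
      case (right post')
      then show ?thesis using step(3)[of pre post'] by (meson converse_rtranclp_into_rtranclp)
    next
      case (left pre')
      then obtain post' B B' a A' where *: "(step I)\<^sup>*\<^sup>* post (B # post')" "act I B ChL a B'"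
        "act I A ChR (colabel a) A'" "ok I (pre' @ A' # B' # post')"
        using step(3)[of pre' post] by blast
      then have "ok I (pre @ A' # B' # post')"
        using ok_step step_appendL[OF left(1), of "A' # B' # post'"] by fastforce
      then show ?thesis using * by blast
    next
      case (tau X)
      then show ?thesis using assms subj_tau by fastforce
    next
      case comm_left
      then show ?thesis using assms subj_act by fastforce
    next
      case (comm_right post' B B' A' a)
      \<comment> \<open>\<open>step_cases\<close> gives \<open>a\<close> to the partner on
        \<open>ChR\<close>, here \<open>A\<close>, while the claim labels \<open>B\<close>; the
        witness is therefore \<open>colabel a\<close>.\<close>
      then show ?thesis using step(2) by (metis colabel_colabel rtranclp.rtrancl_refl)
    qed
  qed
next
  assume "?R pre post"
  then obtain post' B B' a A' where *: "(step I)\<^sup>*\<^sup>* post (B # post')" "act I B ChL a B'"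
        "act I A ChR (colabel a) A'" "ok I (pre @ A' # B' # post')" by blast
  then have "ok I (pre @ A # B # post')"
    using step_comm[of I A "colabel a" A' B B'] ok_step by fastforce
  then show "ok I (pre @ A # post)"
    using ok_steps steps_append[OF *(1), of "pre @ [A]" "[]"] by simp
qed

section \<open>Equivalence of pipeline segments\<close>

text \<open>Contextual equivalence, not an order. The segments may differ in length, which allows a
  composition to be compared with its components.\<close>

definition leq :: "('t \<Rightarrow> 'v set) \<Rightarrow> ('v, 't) proc list \<Rightarrow> ('v, 't) proc list \<Rightarrow> bool" where
  "leq I xs ys \<longleftrightarrow> (\<forall>pre post. ok I (pre @ xs @ post) \<longleftrightarrow> ok I (pre @ ys @ post))"

lemma leq_refl [simp]: "leq I xs xs"
  by (simp add: leq_def)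

lemma leq_sym: "leq I xs ys \<Longrightarrow> leq I ys xs"
  by (simp add: leq_def)

lemma leq_trans [trans]: "leq I xs ys \<Longrightarrow> leq I ys zs \<Longrightarrow> leq I xs zs"
  by (simp add: leq_def)

lemma leq_append: "leq I xs xs' \<Longrightarrow> leq I ys ys' \<Longrightarrow> leq I (xs @ ys) (xs' @ ys')"
  unfolding leq_def by (metis append.assoc)

lemma leq_okD: "leq I xs ys \<Longrightarrow> ok I (pre @ xs @ post) \<longleftrightarrow> ok I (pre @ ys @ post)"
  by (simp add: leq_def)

lemma step_leq: "step I xs ys \<Longrightarrow> leq I xs ys"
  unfolding leq_def using ok_step step_append by blast

lemma leq_Par: "leq I [P \<bowtie> Q] [P, Q]"
  using step_leq[OF step_tau[OF tau_par[of P Q], of I "[]" "[]"]] by simp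

lemma leq_Cond: "eval e (VBool b) \<Longrightarrow> leq I [Cond e P Q] [if b then P else Q]"
  using step_leq[OF step_tau[OF tau_cond[of e b P Q], of I "[]" "[]"]] by simp

lemma leq_comm: "act I A ChR a A' \<Longrightarrow> act I B ChL (colabel a) B' \<Longrightarrow> leq I [A, B] [A', B']"
  using step_leq[OF step_comm[of I A a A' B B' "[]" "[]"]] by simp

text \<open>By \<open>ok_Idle\<close> either side amounts to the success of \<open>pre\<close> and
  of \<open>post\<close>; between the two idle elements lies the empty pipeline, which
  succeeds.\<close>

lemma leq_Idle_Idle: "leq I [Idle, Idle] [Idle]"
proof -
  have "ok I (pre @ Idle # Idle # post) \<longleftrightarrow> ok I (pre @ Idle # post)" for pre post
    using ok_Idle[of I pre "Idle # post"] ok_Idle[of I "[]" post] ok_Idle[of I pre post]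
    by (auto simp: ok_Idles)
  then show ?thesis by (simp add: leq_def)
qed

lemma leq_Par_iff: "leq I [P \<bowtie> Q] xs \<longleftrightarrow> leq I [P, Q] xs" "leq I xs [P \<bowtie> Q] \<longleftrightarrow> leq I xs [P, Q]"
  using leq_Par leq_sym leq_trans by blast+

lemma leq_Par_cong:
  assumes "leq I [P] [P']" "leq I [Q] [Q']"
  shows "leq I [P \<bowtie> Q] [P' \<bowtie> Q']"
  using leq_append[OF assms] by (simp add: leq_Par_iff)

lemma leq_Par_assoc: "leq I [(P \<bowtie> Q) \<bowtie> R] [P \<bowtie> (Q \<bowtie> R)]"
proof -
  have "leq I [P \<bowtie> Q, R] [P, Q, R]" "leq I [P, Q \<bowtie> R] [P, Q, R]"
    using leq_append[OF leq_Par[of I P Q] leq_refl[of I "[R]"]]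
      leq_append[OF leq_refl[of I "[P]"] leq_Par[of I Q R]] by auto
  then show ?thesis by (metis leq_Par_iff leq_sym leq_trans)
qed

section \<open>Comparing and commuting prefixes\<close>

text \<open>By \<open>ok_left_prefix\<close> success depends on a left prefix only through its
  residuals, so matching transitions suffice. The material \<open>xs\<close> and \<open>ys\<close>
  behind the prefixes is carried into the comparison of residuals; the \<open>up\<close> rules rely
  on this.\<close>

lemma leq_left_prefix:
  assumes "subj A = Some ChL" "subj B = Some ChL"
    and AB: "\<And>a A'. act I A ChL a A' \<Longrightarrow> \<exists>B'. act I B ChL a B' \<and> leq I (A' # xs) (B' # ys)"
    and BA: "\<And>a B'. act I B ChL a B' \<Longrightarrow> \<exists>A'. act I A ChL a A' \<and> leq I (A' # xs) (B' # ys)"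
  shows "leq I (A # xs) (B # ys)"
proof -
  have "ok I (pre @ A # xs @ post) \<longleftrightarrow> ok I (pre @ B # ys @ post)" for pre post
    unfolding ok_left_prefix[OF assms(1)] ok_left_prefix[OF assms(2)]
  proof (intro iffI; elim exE conjE)
    fix pre' C C' a A'
    assume "(step I)\<^sup>*\<^sup>* pre (pre' @ [C])" "act I C ChR a C'" "act I A ChL (colabel a) A'"
      and o: "ok I (pre' @ C' # A' # xs @ post)"
    moreover then obtain B' where "act I B ChL (colabel a) B'" "leq I (A' # xs) (B' # ys)"
      using AB by blast
    moreover then have "ok I (pre' @ C' # B' # ys @ post)"
      using o leq_okD[of I "A' # xs" "B' # ys" "pre' @ [C']" post] by simp
    ultimately show "\<exists>pre' C C' a B'. (step I)\<^sup>*\<^sup>* pre (pre' @ [C]) \<and> act I C ChR a C' \<and>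
      act I B ChL (colabel a) B' \<and> ok I (pre' @ C' # B' # ys @ post)" by blast
  next
    fix pre' C C' a B'
    assume "(step I)\<^sup>*\<^sup>* pre (pre' @ [C])" "act I C ChR a C'" "act I B ChL (colabel a) B'"
      and o: "ok I (pre' @ C' # B' # ys @ post)"
    moreover then obtain A' where "act I A ChL (colabel a) A'" "leq I (A' # xs) (B' # ys)"
      using BA by blast
    moreover then have "ok I (pre' @ C' # A' # xs @ post)"
      using o leq_okD[of I "A' # xs" "B' # ys" "pre' @ [C']" post] by simp
    ultimately show "\<exists>pre' C C' a A'. (step I)\<^sup>*\<^sup>* pre (pre' @ [C]) \<and> act I C ChR a C' \<and>
      act I A ChL (colabel a) A' \<and> ok I (pre' @ C' # A' # xs @ post)" by blast
  qed
  then show ?thesis by (simp add: leq_def)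
qed

lemma leq_right_prefix:
  assumes "subj A = Some ChR" "subj B = Some ChR"
    and AB: "\<And>a A'. act I A ChR a A' \<Longrightarrow> \<exists>B'. act I B ChR a B' \<and> leq I (xs @ [A']) (ys @ [B'])"
    and BA: "\<And>a B'. act I B ChR a B' \<Longrightarrow> \<exists>A'. act I A ChR a A' \<and> leq I (xs @ [A']) (ys @ [B'])"
  shows "leq I (xs @ [A]) (ys @ [B])"
proof -
  have "ok I ((pre @ xs) @ A # post) \<longleftrightarrow> ok I ((pre @ ys) @ B # post)" for pre post
    unfolding ok_right_prefix[OF assms(1)] ok_right_prefix[OF assms(2)]
  proof (intro iffI; elim exE conjE)
    fix post' C C' a A'
    assume "(step I)\<^sup>*\<^sup>* post (C # post')" "act I C ChL a C'" "act I A ChR (colabel a) A'"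
      and o: "ok I ((pre @ xs) @ A' # C' # post')"
    moreover then obtain B' where "act I B ChR (colabel a) B'" "leq I (xs @ [A']) (ys @ [B'])"
      using AB by blast
    moreover then have "ok I ((pre @ ys) @ B' # C' # post')"
      using o leq_okD[of I "xs @ [A']" "ys @ [B']" pre "C' # post'"] by simp
    ultimately show "\<exists>post' C C' a B'. (step I)\<^sup>*\<^sup>* post (C # post') \<and> act I C ChL a C' \<and>
      act I B ChR (colabel a) B' \<and> ok I ((pre @ ys) @ B' # C' # post')" by blast
  next
    fix post' C C' a B'
    assume "(step I)\<^sup>*\<^sup>* post (C # post')" "act I C ChL a C'" "act I B ChR (colabel a) B'"
      and o: "ok I ((pre @ ys) @ B' # C' # post')"
    moreover then obtain A' where "act I A ChR (colabel a) A'" "leq I (xs @ [A']) (ys @ [B'])"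
      using BA by blast
    moreover then have "ok I ((pre @ xs) @ A' # C' # post')"
      using o leq_okD[of I "xs @ [A']" "ys @ [B']" pre "C' # post'"] by simp
    ultimately show "\<exists>post' C C' a A'. (step I)\<^sup>*\<^sup>* post (C # post') \<and> act I C ChL a C' \<and>
      act I A ChR (colabel a) A' \<and> ok I ((pre @ xs) @ A' # C' # post')" by blast
  qed
  then show ?thesis by (simp add: leq_def)
qed

lemma leq_prefix:
  assumes "subj A = Some c" "subj B = Some c"
    and "\<And>a A'. act I A c a A' \<Longrightarrow> \<exists>B'. act I B c a B' \<and> leq I [A'] [B']"
    and "\<And>a B'. act I B c a B' \<Longrightarrow> \<exists>A'. act I A c a A' \<and> leq I [A'] [B']"
  shows "leq I [A] [B]"
  using assms leq_left_prefix[of A B I "[]" "[]"] leq_right_prefix[of A B I "[]" "[]"]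
  by (cases c) simp_all

text \<open>The left and right partners are independent, so only the residual after both
  communications matters; the hypotheses say that either order leads to the same one.\<close>

lemma leq_swap_left_right:
  assumes "subj A = Some ChL" "subj B = Some ChR"
    and A: "\<And>a A'. act I A ChL a A' \<Longrightarrow> subj A' = Some ChR"
    and B: "\<And>b B'. act I B ChR b B' \<Longrightarrow> subj B' = Some ChL"
    and AB: "\<And>a b A' X. \<lbrakk>act I A ChL a A'; act I A' ChR b X\<rbrakk>
      \<Longrightarrow> \<exists>B'. act I B ChR b B' \<and> act I B' ChL a X"
    and BA: "\<And>a b B' X. \<lbrakk>act I B ChR b B'; act I B' ChL a X\<rbrakk>
      \<Longrightarrow> \<exists>A'. act I A ChL a A' \<and> act I A' ChR b X"
  shows "leq I [A] [B]"
proof -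
  have "ok I (pre @ A # post) \<longleftrightarrow> ok I (pre @ B # post)" for pre post
  proof
    assume "ok I (pre @ A # post)"
    then obtain pre' C C' a A' where 1: "(step I)\<^sup>*\<^sup>* pre (pre' @ [C])" "act I C ChR a C'"
        "act I A ChL (colabel a) A'" "ok I (pre' @ C' # A' # post)"
      unfolding ok_left_prefix[OF assms(1)] by blast
    from 1(4) have "ok I ((pre' @ [C']) @ A' # post)" by simp
    then obtain post' D D' b X where 2: "(step I)\<^sup>*\<^sup>* post (D # post')" "act I D ChL b D'"
        "act I A' ChR (colabel b) X" "ok I ((pre' @ [C']) @ X # D' # post')"
      unfolding ok_right_prefix[OF A[OF 1(3)]] by blast
    from AB[OF 1(3) 2(3)] obtain B' where
      3: "act I B ChR (colabel b) B'" "act I B' ChL (colabel a) X" by blast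
    \<comment> \<open>The same partners \<open>C\<close> and \<open>D\<close> are reused in the
      opposite order: \<open>B\<close> meets \<open>D\<close> first, and its residual
      \<open>B'\<close> then meets \<open>C\<close>.\<close>
    have "ok I (pre @ B' # D' # post')"
      unfolding ok_left_prefix[OF B[OF 3(1)]] using 1 2(4) 3(2) by force
    then show "ok I (pre @ B # post)"
      unfolding ok_right_prefix[OF assms(2)] using 2 3 by blast
  next
    assume "ok I (pre @ B # post)"
    then obtain post' D D' b B' where 1: "(step I)\<^sup>*\<^sup>* post (D # post')" "act I D ChL b D'"
        "act I B ChR (colabel b) B'" "ok I (pre @ B' # D' # post')"
      unfolding ok_right_prefix[OF assms(2)] by blast
    from 1(4) obtain pre' C C' a X where 2: "(step I)\<^sup>*\<^sup>* pre (pre' @ [C])" "act I C ChR a C'"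
        "act I B' ChL (colabel a) X" "ok I (pre' @ C' # X # D' # post')"
      unfolding ok_left_prefix[OF B[OF 1(3)]] by blast
    from BA[OF 1(3) 2(3)] obtain A' where
      3: "act I A ChL (colabel a) A'" "act I A' ChR (colabel b) X" by blast
    have "ok I ((pre' @ [C']) @ A' # post)"
      unfolding ok_right_prefix[OF A[OF 3(1)]] using 1 2(4) 3(2) by force
    then show "ok I (pre @ A # post)"
      unfolding ok_left_prefix[OF assms(1)] using 2 3 by force
  qed
  then show ?thesis by (simp add: leq_def)
qed

lemma leq_swap:
  assumes "subj A = Some c" "subj B = Some (co c)"
    and A: "\<And>a A'. act I A c a A' \<Longrightarrow> subj A' = Some (co c)"
    and B: "\<And>b B'. act I B (co c) b B' \<Longrightarrow> subj B' = Some c"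
    and AB: "\<And>a b A' X. \<lbrakk>act I A c a A'; act I A' (co c) b X\<rbrakk>
      \<Longrightarrow> \<exists>B'. act I B (co c) b B' \<and> act I B' c a X"
    and BA: "\<And>a b B' X. \<lbrakk>act I B (co c) b B'; act I B' c a X\<rbrakk>
      \<Longrightarrow> \<exists>A'. act I A c a A' \<and> act I A' (co c) b X"
  shows "leq I [A] [B]"
proof (cases c)
  case ChL
  then show ?thesis using assms by (intro leq_swap_left_right) auto
next
  case ChR
  then show ?thesis using assms by (intro leq_sym[OF leq_swap_left_right]) auto
qed


section \<open>Substitution\<close>

lemma up_simps [simp]:
  "up \<sigma> 0 = Var 0" "up \<sigma> (Suc n) = subst_expr (\<sigma> n) (\<lambda>m. Var (Suc m))"
  by (simp_all add: up_def)

lemma subst_expr_subst_expr: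
  "subst_expr (subst_expr e \<sigma>) \<tau> = subst_expr e (\<lambda>n. subst_expr (\<sigma> n) \<tau>)"
  by (induction e) auto

lemma subst_expr_Var [simp]: "subst_expr e Var = e"
  by (induction e) auto

lemma up_Var [simp]: "up Var = Var"
  by (auto simp: up_def split: nat.splits)

lemma up_comp: "(\<lambda>n. subst_expr (up \<sigma> n) (up \<tau>)) = up (\<lambda>n. subst_expr (\<sigma> n) \<tau>)"
proof
  fix n
  show "subst_expr (up \<sigma> n) (up \<tau>) = up (\<lambda>n. subst_expr (\<sigma> n) \<tau>) n"
    by (cases n) (simp_all add: subst_expr_subst_expr)
qed

lemma subst_subst: "subst (subst P \<sigma>) \<tau> = subst P (\<lambda>n. subst_expr (\<sigma> n) \<tau>)"
  by (induction P arbitrary: \<sigma> \<tau>) (simp_all add: subst_expr_subst_expr up_comp)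

lemma subst_Var [simp]: "subst P Var = P"
  by (induction P) auto

lemma inst_subst_up [simp]: "inst (subst P (up \<sigma>)) e = subst P (case_nat e \<sigma>)"
proof -
  have "(\<lambda>n. subst_expr (up \<sigma> n) (case_nat e Var)) = case_nat e \<sigma>"
    by (rule ext) (simp add: up_def subst_expr_subst_expr split: nat.splits)
  then show ?thesis by (simp add: inst_def subst_subst)
qed

lemma subst_shift [simp]: "subst (shift P) (case_nat e \<sigma>) = subst P \<sigma>"
  by (simp add: shift_def subst_subst)

text \<open>Swapping two inputs swaps the order in which the received values are pushed onto
  \<sigma>; \<open>exchange\<close> compensates for this.\<close>

lemma subst_exchange [simp]:
  "subst (exchange P) (case_nat e (case_nat f \<sigma>)) = subst P (case_nat f (case_nat e \<sigma>))"
proof -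
  have "(\<lambda>n. subst_expr ((Var(0 := Var 1, 1 := Var 0)) n) (case_nat e (case_nat f \<sigma>)))
    = case_nat f (case_nat e \<sigma>)"
    by (rule ext) (simp split: nat.splits)
  then show ?thesis by (simp add: exchange_def subst_subst)
qed

lemma subst_inst_Var: "subst (inst P (Var y)) \<sigma> = subst P (case_nat (\<sigma> y) \<sigma>)"
proof -
  have "(\<lambda>n. subst_expr (case n of 0 \<Rightarrow> Var y | Suc x \<Rightarrow> Var x) \<sigma>) = case_nat (\<sigma> y) \<sigma>"
    by (rule ext) (simp split: nat.splits)
  then show ?thesis by (simp add: inst_def subst_subst)
qed

lemma subst_select: "subst (select l P Q) \<sigma> = select l (subst P \<sigma>) (subst Q \<sigma>)"
  by (cases l) auto

lemma subj_subst [simp]: "subj (subst P \<sigma>) = subj P"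
  by (cases P) auto

text \<open>Residuals are again instances of the original subterm, under \<sigma> possibly extended
  by the received value. The residuals of two reordered prefixes can then be compared
  directly.\<close>

lemma act_subst:
  "act I (subst (Inp c t P) \<sigma>) d a X \<longleftrightarrow>
    (\<exists>v. has_btype I v t \<and> d = c \<and> a = LIn v \<and> X = subst P (case_nat (Val v) \<sigma>))"
  "act I (subst (Out c e P) \<sigma>) d a X \<longleftrightarrow>
    (\<exists>v. eval (subst_expr e \<sigma>) v \<and> d = c \<and> a = LOut v \<and> X = subst P \<sigma>)"
  "act I (subst (Sel c l P) \<sigma>) d a X \<longleftrightarrow> d = c \<and> a = LSel l \<and> X = subst P \<sigma>"
  "act I (subst (Bra c P Q) \<sigma>) d a X \<longleftrightarrow> (\<exists>l. d = c \<and> a = LBra l \<and> X = subst (select l P Q) \<sigma>)"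
  by (simp_all add: subst_select)

lemma select_prefix [simp]:
  "select l (Inp c t P) (Inp c t Q) = Inp c t (select l P Q)"
  "select l (Out c e P) (Out c e Q) = Out c e (select l P Q)"
  "select l (Sel c m P) (Sel c m Q) = Sel c m (select l P Q)"
  "select l (Bra c P1 P2) (Bra c Q1 Q2) = Bra c (select l P1 Q1) (select l P2 Q2)"
  by (cases l; simp)+

text \<open>Interchange law behind the swapping of two branchings.\<close>

lemma select_select:
  "select l (select m P1 Q1) (select m P2 Q2) = select m (select l P1 P2) (select l Q1 Q2)"
  by (cases l; cases m) auto

section \<open>Reduction preserves success\<close>

text \<open>Only values of type \<open>t\<close> can be received; hence open bodies need to be
  compared only under well-typed instances.\<close>

lemma leq_Inp:
  assumes "\<And>v. has_btype I v t \<Longrightarrow> leq I [inst P (Val v)] [inst Q (Val v)]"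
  shows "leq I [Inp c t P] [Inp c t Q]"
  by (rule leq_prefix[of _ c]) (use assms in auto)

lemma leq_Out: "leq I [P] [Q] \<Longrightarrow> leq I [Out c e P] [Out c e Q]"
  by (rule leq_prefix[of _ c]) auto

lemma leq_Sel: "leq I [P] [Q] \<Longrightarrow> leq I [Sel c l P] [Sel c l Q]"
  by (rule leq_prefix[of _ c]) auto

lemma leq_Bra: "leq I [P] [P'] \<Longrightarrow> leq I [Q] [Q'] \<Longrightarrow> leq I [Bra c P Q] [Bra c P' Q']"
proof (rule leq_prefix[of _ c])
  assume "leq I [P] [P']" "leq I [Q] [Q']"
  then have "leq I [select l P Q] [select l P' Q']" for l by (cases l) auto
  then show "\<And>a A'. act I (Bra c P Q) c a A' \<Longrightarrow> \<exists>B'. act I (Bra c P' Q') c a B' \<and> leq I [A'] [B']"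
    "\<And>a B'. act I (Bra c P' Q') c a B' \<Longrightarrow> \<exists>A'. act I (Bra c P Q) c a A' \<and> leq I [A'] [B']"
    by auto
qed auto

lemma leq_Cond_cong:
  assumes "leq I [P] [P']" "leq I [Q] [Q']"
  shows "leq I [Cond e P Q] [Cond e P' Q']"
proof (cases "\<exists>b. eval e (VBool b)")
  case True
  then obtain b where b: "eval e (VBool b)" by blast
  have "leq I [if b then P else Q] [if b then P' else Q']" using assms by auto
  then show ?thesis using leq_Cond[OF b] leq_trans leq_sym by metis
next
  case False
  \<comment> \<open>With a guard that yields no boolean, both conditionals fail in every
    pipeline.\<close>
  then show ?thesis unfolding leq_def using ok_Cond_evaluates by fastforce
qed

text \<open>The claim ranges over all substitutions because congruence goes under inputs, where the
  bodies are compared after instantiation.\<close>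

lemma scong_leq: "P \<equiv>\<^sub>s Q \<Longrightarrow> leq I [subst P \<sigma>] [subst Q \<sigma>]"
proof (induction arbitrary: \<sigma> rule: scong.induct)
  case sc_nil
  then show ?case using leq_Idle_Idle by (simp add: leq_Par_iff)
next
  case sc_assoc
  then show ?case by (simp add: leq_Par_assoc)
next
  case sc_sym
  then show ?case using leq_sym by blast
next
  case sc_trans
  then show ?case using leq_trans by blast
qed (simp_all add: leq_Inp leq_Out leq_Sel leq_Bra leq_Cond_cong leq_Par_cong)

lemma scong_leq': "P \<equiv>\<^sub>s Q \<Longrightarrow> leq I [P] [Q]"
  using scong_leq[of P Q I Var] by simp

lemma leq_rplug: "leq I [P] [Q] \<Longrightarrow> leq I [rplug C P] [rplug C Q]"
  by (induction C) (auto intro: leq_Par_cong)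

text \<open>Each basic reduction is a pipeline step once the outer composition is unfolded. As
  \<open>leq\<close> is symmetric, reduction neither loses nor creates success.\<close>

lemma red_leq: "red I P Q \<Longrightarrow> leq I [P] [Q]"
proof (induction rule: red.induct)
  case (red_comm_r e v t P Q)
  then show ?case using leq_comm[of I "Out ChR e P" "LOut v" P "Inp ChL t Q"]
    by (simp add: leq_Par_iff)
next
  case (red_comm_l e v t P Q)
  then show ?case using leq_comm[of I "Inp ChR t P" "LIn v" _ "Out ChL e Q"]
    by (simp add: leq_Par_iff)
next
  case (red_sel_r l P Q1 Q2)
  then show ?case using leq_comm[of I "Sel ChR l P" "LSel l" P "Bra ChL Q1 Q2"]
    by (simp add: leq_Par_iff)
next
  case (red_sel_l P1 P2 l Q)
  then show ?case using leq_comm[of I "Bra ChR P1 P2" "LBra l" _ "Sel ChL l Q"]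
    by (simp add: leq_Par_iff)
next
  case (red_cond e b P Q)
  then show ?case using leq_Cond by metis
next
  case red_ctx
  then show ?case by (simp add: leq_rplug)
next
  case red_struct
  then show ?case using scong_leq' leq_trans by blast
qed

section \<open>Correctness as success\<close>

text \<open>A termination measure. Composition adds nothing of its own, which makes the weight
  invariant under structural congruence; both branches count, so either of them may survive.\<close>

primrec weight :: "('v, 't) proc \<Rightarrow> nat" where
  "weight Idle = 0"
| "weight (Inp c t P) = Suc (weight P)"
| "weight (Out c e P) = Suc (weight P)"
| "weight (Sel c l P) = Suc (weight P)"
| "weight (Bra c P Q) = Suc (weight P + weight Q)"
| "weight (Cond e P Q) = Suc (weight P + weight Q)"
| "weight (P \<bowtie> Q) = weight P + weight Q"

lemma weight_subst [simp]: "weight (subst P \<sigma>) = weight P"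
  by (induction P arbitrary: \<sigma>) auto

lemma weight_inst [simp]: "weight (inst P e) = weight P"
  by (simp add: inst_def)

lemma weight_select: "weight (select l P Q) \<le> weight P + weight Q"
  by (cases l) auto

lemma scong_weight: "P \<equiv>\<^sub>s Q \<Longrightarrow> weight P = weight Q"
  by (induction rule: scong.induct) auto

lemma weight_rplug: "weight P < weight Q \<Longrightarrow> weight (rplug C P) < weight (rplug C Q)"
  by (induction C) auto

lemma red_weight: "red I P Q \<Longrightarrow> weight Q < weight P"
proof (induction rule: red.induct)
  case (red_sel_r l P Q1 Q2)
  then show ?case using weight_select[of l Q1 Q2] by simp
next
  case (red_sel_l P1 P2 l Q)
  then show ?case using weight_select[of l P1 P2] by simp
qed (auto simp: weight_rplug scong_weight)

lemma red_normal_form: "\<exists>Q. (red I)\<^sup>*\<^sup>* P Q \<and> (\<nexists>Q'. red I Q Q')"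
proof (induction "weight P" arbitrary: P rule: less_induct)
  case less
  then show ?case
    by (metis red_weight converse_rtranclp_into_rtranclp rtranclp.rtrancl_refl)
qed

section \<open>Reading pipelines back as processes\<close>

text \<open>Singletons have their own clause because \<open>Idle\<close> is not a unit of
  composition: only \<open>Idle \<bowtie> Idle\<close> is congruent to \<open>Idle\<close>.\<close>

fun join :: "('v, 't) proc list \<Rightarrow> ('v, 't) proc" where
  "join [] = Idle"
| "join [P] = P"
| "join (P # Q # xs) = P \<bowtie> join (Q # xs)"

lemma join_Cons: "xs \<noteq> [] \<Longrightarrow> join (P # xs) = P \<bowtie> join xs"
  by (cases xs) auto

lemma join_append: "xs \<noteq> [] \<Longrightarrow> ys \<noteq> [] \<Longrightarrow> join (xs @ ys) \<equiv>\<^sub>s join xs \<bowtie> join ys"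
proof (induction xs rule: join.induct)
  case (2 P)
  then show ?case by (simp add: join_Cons sc_refl)
next
  case (3 P Q xs)
  then have "P \<bowtie> join ((Q # xs) @ ys) \<equiv>\<^sub>s P \<bowtie> (join (Q # xs) \<bowtie> join ys)"
    by (intro sc_par sc_refl) auto
  then show ?case using sc_trans sc_sym sc_assoc by (metis append_Cons join.simps(3))
qed auto

text \<open>One context serves all segments, so it can be used both before and after a step.\<close>

lemma join_segment: "\<exists>C. \<forall>zs. zs \<noteq> [] \<longrightarrow> join (pre @ zs @ post) \<equiv>\<^sub>s rplug C (join zs)"
proof (induction pre)
  case Nil
  show ?case
  proof (cases "post = []")
    case True
    then show ?thesis by (intro exI[of _ RHole]) (simp add: sc_refl)
  next
    case False
    then show ?thesis by (intro exI[of _ "RParL RHole (join post)"]) (simp add: join_append)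
  qed
next
  case (Cons P pre)
  then obtain C where "\<forall>zs. zs \<noteq> [] \<longrightarrow> join (pre @ zs @ post) \<equiv>\<^sub>s rplug C (join zs)" by blast
  then show ?case by (intro exI[of _ "RParR P C"]) (simp add: join_Cons sc_par sc_refl)
qed

lemma scong_rplug: "P \<equiv>\<^sub>s Q \<Longrightarrow> rplug C P \<equiv>\<^sub>s rplug C Q"
  by (induction C) (auto intro: sc_par sc_refl)

lemma act_red:
  assumes "act I A ChR a A'" "act I B ChL (colabel a) B'"
  shows "red I (A \<bowtie> B) (A' \<bowtie> B')"
  using assms by (cases A; cases B) (auto intro: red.intros)

lemma join_tau: "tau A X \<Longrightarrow> A \<equiv>\<^sub>s join X \<or> red I A (join X)"
  by (auto elim!: tau.cases intro: sc_refl red_cond)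

text \<open>Unfolding a composition is absorbed by structural congruence; conditionals and
  communications are genuine reductions.\<close>

lemma step_join: "step I xs ys \<Longrightarrow> join xs \<equiv>\<^sub>s join ys \<or> red I (join xs) (join ys)"
proof (induction rule: step.induct)
  case (step_tau A X xs ys)
  obtain C where C: "\<And>zs. zs \<noteq> [] \<Longrightarrow> join (xs @ zs @ ys) \<equiv>\<^sub>s rplug C (join zs)"
    using join_segment[of xs ys] by blast
  have "X \<noteq> []" using step_tau by (auto elim: tau.cases)
  with C[of "[A]"] C[of X] have
    "join (xs @ A # ys) \<equiv>\<^sub>s rplug C A" "rplug C (join X) \<equiv>\<^sub>s join (xs @ X @ ys)"
    by (auto intro: sc_sym)
  then show ?case using join_tau[OF step_tau, of I]
    by (meson scong_rplug red_ctx red_struct sc_trans)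
next
  case (step_comm A a A' B B' xs ys)
  obtain C where C: "\<And>zs. zs \<noteq> [] \<Longrightarrow> join (xs @ zs @ ys) \<equiv>\<^sub>s rplug C (join zs)"
    using join_segment[of xs ys] by blast
  from C[of "[A, B]"] C[of "[A', B']"] have
    "join (xs @ A # B # ys) \<equiv>\<^sub>s rplug C (A \<bowtie> B)" "rplug C (A' \<bowtie> B') \<equiv>\<^sub>s join (xs @ A' # B' # ys)"
    by (auto intro: sc_sym)
  then show ?case using act_red[OF step_comm] by (meson red_ctx red_struct)
qed

lemma join_Idles: "set xs \<subseteq> {Idle} \<Longrightarrow> join xs \<equiv>\<^sub>s Idle"
proof (induction xs rule: join.induct)
  case (3 P Q xs)
  then have "P \<bowtie> join (Q # xs) \<equiv>\<^sub>s Idle \<bowtie> Idle" by (intro sc_par) (auto intro: sc_refl)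
  then show ?case using sc_trans sc_nil by fastforce
qed (auto intro: sc_refl)

text \<open>Progress: the purely structural steps of the successful run are skipped until one is a
  reduction; if none is, the process was congruent to \<open>Idle\<close> from the start.\<close>

lemma ok_join: "ok I xs \<Longrightarrow> join xs \<equiv>\<^sub>s Idle \<or> (\<exists>Q. red I (join xs) Q)"
proof (induction rule: ok_induct)
  case (Idles xs)
  then show ?case using join_Idles by blast
next
  case (step xs ys)
  then show ?case using step_join[of I xs ys] by (meson red_struct sc_refl sc_trans)
qed

text \<open>Success is invariant under reduction. Termination supplies an irreducible reduct, idle
  if \<open>P\<close> is correct; conversely, irreducible reducts of a successful process are idle
  by \<open>ok_join\<close>.\<close>

lemma correct_iff_ok: "correct I P \<longleftrightarrow> ok I [P]"
proof -
  have inv: "ok I [P] \<longleftrightarrow> ok I [Q]" if "leq I [P] [Q]" for P Q :: "('b, 'a) proc"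
    using leq_okD[OF that, of "[]" "[]"] by simp
  have invs: "ok I [P] \<longleftrightarrow> ok I [Q]" if "(red I)\<^sup>*\<^sup>* P Q" for Q
    using that by (induction rule: rtranclp_induct) (auto dest: red_leq inv)
  show ?thesis
  proof
    assume "correct I P"
    then obtain Q where Q: "(red I)\<^sup>*\<^sup>* P Q" "Q \<equiv>\<^sub>s Idle"
      using red_normal_form unfolding correct_def by blast
    have "ok I [Idle]" by (simp add: ok_Idles)
    then show "ok I [P]" using Q invs inv scong_leq' by blast
  next
    assume "ok I [P]"
    then show "correct I P" unfolding correct_def using invs ok_join[of I "[_]"] by auto
  qed
qed

lemma leq_equivalent: "leq I [P] [Q] \<Longrightarrow> equivalent I P Q"
  unfolding equivalent_def correct_iff_ok
  using leq_rplug leq_okD[of I "[_]" "[_]" "[]" "[]"] by fastforce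

section \<open>Typing\<close>

lemma sess_upd [simp]: "(sess c T S)(c := T') = sess c T' S"
  by (auto simp: sess_def)

lemma sess_same [simp]: "sess c T S c = T"
  by (simp add: sess_def)

lemma sess_eta: "sess c (\<Delta> c) (\<Delta> (co c)) = \<Delta>"
proof
  fix d
  show "sess c (\<Delta> c) (\<Delta> (co c)) d = \<Delta> d" by (cases c; cases d) (auto simp: sess_def)
qed

lemma sess_upd_eta: "sess c T (\<Delta> (co c)) = \<Delta>(c := T)"
  by (metis sess_eta sess_upd)

lemma co_neq [simp]: "co c \<noteq> c" "c \<noteq> co c"
  by (cases c; simp)+

lemma upd_co_twist: "\<Delta>(co c := S, c := T) = \<Delta>(c := T, co c := S)"
  by (simp add: fun_upd_twist)

text \<open>The inversion rules speak of an arbitrary \<Delta> and of updates rather than of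
  \<open>sess\<close>. Changes to opposite channels then commute, whatever \<open>c\<close>
  is.\<close>

lemma typed_Inp:
  "typed I \<Gamma> (Inp c t P) \<Delta> \<longleftrightarrow> (\<exists>T. \<Delta> c = Recv t T \<and> typed I (t # \<Gamma>) P (\<Delta>(c := T)))"
proof
  assume "\<exists>T. \<Delta> c = Recv t T \<and> typed I (t # \<Gamma>) P (\<Delta>(c := T))"
  then show "typed I \<Gamma> (Inp c t P) \<Delta>"
    using ty_inp[of I t \<Gamma> P c _ "\<Delta> (co c)"] by (metis sess_eta sess_upd_eta)
qed (auto elim: typed.cases)

lemma typed_Out:
  "typed I \<Gamma> (Out c e P) \<Delta> \<longleftrightarrow>
    (\<exists>t T. \<Delta> c = Send t T \<and> expr_typed I \<Gamma> e t \<and> typed I \<Gamma> P (\<Delta>(c := T)))"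
proof
  assume "\<exists>t T. \<Delta> c = Send t T \<and> expr_typed I \<Gamma> e t \<and> typed I \<Gamma> P (\<Delta>(c := T))"
  then show "typed I \<Gamma> (Out c e P) \<Delta>"
    using ty_out[of I \<Gamma> e _ P c _ "\<Delta> (co c)"] by (metis sess_eta sess_upd_eta)
qed (auto elim: typed.cases)

lemma typed_Sel:
  "typed I \<Gamma> (Sel c l P) \<Delta> \<longleftrightarrow>
    (\<exists>T1 T2. \<Delta> c = Choice T1 T2 \<and> typed I \<Gamma> P (\<Delta>(c := select l T1 T2)))"
proof
  assume "\<exists>T1 T2. \<Delta> c = Choice T1 T2 \<and> typed I \<Gamma> P (\<Delta>(c := select l T1 T2))"
  then show "typed I \<Gamma> (Sel c l P) \<Delta>"
    using ty_inl[of I \<Gamma> P c _ "\<Delta> (co c)"] ty_inr[of I \<Gamma> P c _ "\<Delta> (co c)"]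
    by (cases l) (metis select.simps sess_eta sess_upd_eta)+
qed (auto elim: typed.cases)

lemma typed_Bra:
  "typed I \<Gamma> (Bra c P Q) \<Delta> \<longleftrightarrow>
    (\<exists>T1 T2. \<Delta> c = Branch T1 T2 \<and> typed I \<Gamma> P (\<Delta>(c := T1)) \<and> typed I \<Gamma> Q (\<Delta>(c := T2)))"
proof
  assume "\<exists>T1 T2. \<Delta> c = Branch T1 T2 \<and> typed I \<Gamma> P (\<Delta>(c := T1)) \<and> typed I \<Gamma> Q (\<Delta>(c := T2))"
  then show "typed I \<Gamma> (Bra c P Q) \<Delta>"
    using ty_bra[of I \<Gamma> P c _ "\<Delta> (co c)" Q] by (metis sess_eta sess_upd_eta)
qed (auto elim: typed.cases)

lemma typed_Cond:
  "typed I \<Gamma> (Cond e P Q) \<Delta> \<longleftrightarrow> expr_typed I \<Gamma> e TBool \<and> typed I \<Gamma> P \<Delta> \<and> typed I \<Gamma> Q \<Delta>"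
proof
  assume "expr_typed I \<Gamma> e TBool \<and> typed I \<Gamma> P \<Delta> \<and> typed I \<Gamma> Q \<Delta>"
  then show "typed I \<Gamma> (Cond e P Q) \<Delta>" by (metis ty_cond sess_eta)
qed (auto elim: typed.cases)

lemma typed_Par:
  "typed I \<Gamma> (P \<bowtie> Q) \<Delta> \<longleftrightarrow>
    (\<exists>T. typed I \<Gamma> P (\<Delta>(ChR := T)) \<and> typed I \<Gamma> Q (\<Delta>(ChL := dual T)))"
proof
  assume "typed I \<Gamma> (P \<bowtie> Q) \<Delta>"
  then show "\<exists>T. typed I \<Gamma> P (\<Delta>(ChR := T)) \<and> typed I \<Gamma> Q (\<Delta>(ChL := dual T))"
  proof (cases rule: typed.cases)
    case (ty_par T T' S)
    moreover have "(sess ChL T S)(ChR := T') = sess ChL T T'"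
      using sess_eta[of ChL "(sess ChL T S)(ChR := T')"] by simp
    ultimately show ?thesis by (intro exI[of _ T']) auto
  qed
next
  assume "\<exists>T. typed I \<Gamma> P (\<Delta>(ChR := T)) \<and> typed I \<Gamma> Q (\<Delta>(ChL := dual T))"
  then obtain T where T: "typed I \<Gamma> P (\<Delta>(ChR := T))" "typed I \<Gamma> Q (\<Delta>(ChL := dual T))" by blast
  have "\<Delta>(ChR := T) = sess ChL (\<Delta> ChL) T" "\<Delta>(ChL := dual T) = sess ChL (dual T) (\<Delta> ChR)"
    using sess_eta[of ChL "\<Delta>(ChR := T)"] sess_eta[of ChL "\<Delta>(ChL := dual T)"] by auto
  then show "typed I \<Gamma> (P \<bowtie> Q) \<Delta>" using ty_par[of I \<Gamma> P "\<Delta> ChL" T Q "\<Delta> ChR"] T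
    sess_eta[of ChL \<Delta>] by simp
qed

lemma typed_Idle: "typed I \<Gamma> Idle \<Delta> \<longleftrightarrow> \<Delta> = sess ChL End End"
  by (auto elim: typed.cases intro: ty_nil)

lemmas typed_iffs = typed_Idle typed_Inp typed_Out typed_Sel typed_Bra typed_Cond typed_Par

lemma expr_typed_Var [simp]: "expr_typed I \<Gamma> (Var n) t \<longleftrightarrow> n < length \<Gamma> \<and> \<Gamma> ! n = t"
  by (auto elim: expr_typed.cases intro: expr_typed.intros)

lemma expr_typed_Val [simp]: "expr_typed I \<Gamma> (Val v) t \<longleftrightarrow> has_btype I v t"
  by (auto elim: expr_typed.cases intro: expr_typed.intros)

lemma expr_typed_subst:
  assumes "expr_typed I \<Gamma> e t" "\<And>n. n < length \<Gamma> \<Longrightarrow> expr_typed I \<Gamma>' (\<sigma> n) (\<Gamma> ! n)"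
  shows "expr_typed I \<Gamma>' (subst_expr e \<sigma>) t"
  using assms by (induction rule: expr_typed.induct) (auto intro: et_eq)

lemma typed_subst:
  assumes "typed I \<Gamma> P \<Delta>" "\<And>n. n < length \<Gamma> \<Longrightarrow> expr_typed I \<Gamma>' (\<sigma> n) (\<Gamma> ! n)"
  shows "typed I \<Gamma>' (subst P \<sigma>) \<Delta>"
  using assms
proof (induction P arbitrary: \<Gamma> \<Gamma>' \<Delta> \<sigma>)
  case (Inp c t P)
  have "expr_typed I (t # \<Gamma>') (up \<sigma> n) ((t # \<Gamma>) ! n)" if "n < length (t # \<Gamma>)" for n
    using that Inp.prems(2) by (cases n) (auto intro!: expr_typed_subst)
  then show ?case
    using Inp.prems(1) Inp.IH[of "t # \<Gamma>" _ "t # \<Gamma>'" "up \<sigma>"] by (auto simp: typed_iffs)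
qed (auto simp: typed_iffs expr_typed_subst; blast intro: expr_typed_subst)+

lemma typed_shift: "typed I \<Gamma> P \<Delta> \<Longrightarrow> typed I (t # \<Gamma>) (shift P) \<Delta>"
  unfolding shift_def by (erule typed_subst) simp

lemma typed_exchange:
  assumes "typed I (s # t # \<Gamma>) P \<Delta>"
  shows "typed I (t # s # \<Gamma>) (exchange P) \<Delta>"
  unfolding exchange_def
proof (rule typed_subst[OF assms])
  fix n assume "n < length (s # t # \<Gamma>)"
  then show "expr_typed I (t # s # \<Gamma>) ((Var(0 := Var 1, 1 := Var 0)) n) ((s # t # \<Gamma>) ! n)"
    by (auto simp: nth_Cons split: nat.splits)
qed

lemma typed_inst_Var:
  assumes "typed I (t # \<Gamma>) P \<Delta>" "expr_typed I \<Gamma> (Var y) t"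
  shows "typed I \<Gamma> (inst P (Var y)) \<Delta>"
  unfolding inst_def
proof (rule typed_subst[OF assms(1)])
  fix n assume "n < length (t # \<Gamma>)"
  then show "expr_typed I \<Gamma> (case n of 0 \<Rightarrow> Var y | Suc x \<Rightarrow> Var x) ((t # \<Gamma>) ! n)"
    using assms(2) by (cases n) auto
qed

lemma typed_id_proc: "typed I \<Gamma> (id_proc T) \<Delta> \<Longrightarrow> \<Delta> ChR = T"
proof (induction T arbitrary: \<Gamma> \<Delta>)
  case End
  then show ?case by (simp add: typed_iffs sess_def)
qed (fastforce simp: typed_iffs)+

lemma has_btype_VBool: "has_btype I (VBool b) t \<longleftrightarrow> t = TBool"
  by (cases t) auto

lemma has_btype_TBool: "has_btype I v TBool \<longleftrightarrow> (\<exists>b. v = VBool b)"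
  by (cases v) auto

lemma typed_splug:
  assumes "\<And>\<Gamma> \<Delta>. typed I \<Gamma> P \<Delta> \<Longrightarrow> typed I \<Gamma> Q \<Delta>" "typed I \<Gamma> (splug E P) \<Delta>"
  shows "typed I \<Gamma> (splug E Q) \<Delta>"
  using assms(2) by (induction E arbitrary: \<Gamma> \<Delta>) (auto simp: typed_iffs assms(1); blast)+

text \<open>Subject reduction, for open processes because symbolic contexts go under inputs.\<close>

lemma symred_typed: "P \<leadsto> Q \<Longrightarrow> typed I \<Gamma> P \<Delta> \<Longrightarrow> typed I \<Gamma> Q \<Delta>"
proof (induction arbitrary: \<Gamma> \<Delta> rule: symred.induct)
  case (ident T)
  then show ?case
    \<comment> \<open>\<open>typed_id_proc\<close> makes both the intermediate type and
      \<open>\<Delta> ChR\<close> equal to \<open>T\<close>, so the left copy already has the typing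
      \<Delta>.\<close>
    by (metis typed_Par typed_id_proc fun_upd_other fun_upd_same fun_upd_triv chan.distinct(1))
next
  case (ctx P Q E)
  then show ?case using typed_splug by blast
next
  case (comm_sel_r l P Q1 Q2)
  then show ?case by (cases l) (auto simp: typed_iffs)
next
  case (comm_sel_l P1 P2 l Q)
  then show ?case by (cases l) (auto simp: typed_iffs)
next
  case (comm_r y P t Q)
  then show ?case using typed_inst_Var[of I t \<Gamma> Q _ y] by (fastforce simp: typed_iffs)
next
  case (comm_l t P y Q)
  then show ?case using typed_inst_Var[of I t \<Gamma> P _ y] by (fastforce simp: typed_iffs)
next
  case (cond x c P)
  \<comment> \<open>Sending a boolean constant forces the payload type to be \<open>TBool\<close>,
    which is the type of the guard variable.\<close>
  then show ?case by (auto simp: typed_iffs has_btype_VBool)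
qed (auto simp: typed_iffs upd_co_twist fun_upd_twist[of ChL ChR] intro: typed_shift typed_exchange)

section \<open>Symbolic reduction preserves success\<close>

definition closing :: "('t \<Rightarrow> 'v set) \<Rightarrow> 't btype list \<Rightarrow> (nat \<Rightarrow> 'v expr) \<Rightarrow> bool" where
  "closing I \<Gamma> \<sigma> \<longleftrightarrow> (\<forall>n < length \<Gamma>. \<exists>v. \<sigma> n = Val v \<and> has_btype I v (\<Gamma> ! n))"

lemma closing_Cons: "has_btype I v t \<Longrightarrow> closing I \<Gamma> \<sigma> \<Longrightarrow> closing I (t # \<Gamma>) (case_nat (Val v) \<sigma>)"
  by (auto simp: closing_def nth_Cons split: nat.splits)

lemma closing_Var:
  assumes "closing I \<Gamma> \<sigma>" "expr_typed I \<Gamma> (Var x) t"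
  obtains v where "\<sigma> x = Val v" "has_btype I v t"
  using assms by (auto simp: closing_def)

lemma closing_TBool:
  assumes "closing I \<Gamma> \<sigma>" "expr_typed I \<Gamma> (Var x) TBool"
  obtains b where "\<sigma> x = Val (VBool b)"
  using assms by (metis closing_Var has_btype_TBool)

section \<open>Moving prefixes out of a composition\<close>

text \<open>A prefix on \<open>ChL\<close> deals only with what lies to its left, so
  \<open>Q\<close> can stay behind it as a separate element or move into its residuals.\<close>

lemma leq_up_left:
  assumes "subj A = Some ChL" "subj B = Some ChL"
    and "\<And>a B'. act I B ChL a B' \<longleftrightarrow> (\<exists>A'. act I A ChL a A' \<and> B' = A' \<bowtie> Q)"
  shows "leq I [A \<bowtie> Q] [B]"
  unfolding leq_Par_iff
proof (rule leq_left_prefix[OF assms(1,2)])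
  fix a A' assume "act I A ChL a A'"
  then show "\<exists>B'. act I B ChL a B' \<and> leq I (A' # [Q]) (B' # [])"
    by (intro exI[of _ "A' \<bowtie> Q"]) (auto simp: assms(3) leq_Par_iff)
next
  fix a B' assume "act I B ChL a B'"
  then show "\<exists>A'. act I A ChL a A' \<and> leq I (A' # [Q]) (B' # [])"
    by (auto simp: assms(3) leq_Par_iff)
qed

lemma leq_up_right:
  assumes "subj A = Some ChR" "subj B = Some ChR"
    and "\<And>a B'. act I B ChR a B' \<longleftrightarrow> (\<exists>A'. act I A ChR a A' \<and> B' = P \<bowtie> A')"
  shows "leq I [P \<bowtie> A] [B]"
proof -
  have "leq I ([P] @ [A]) ([] @ [B])"
  proof (rule leq_right_prefix[OF assms(1,2)])
    fix a A' assume "act I A ChR a A'"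
    then show "\<exists>B'. act I B ChR a B' \<and> leq I ([P] @ [A']) ([] @ [B'])"
      by (intro exI[of _ "P \<bowtie> A'"]) (auto simp: assms(3) leq_Par_iff)
  next
    fix a B' assume "act I B ChR a B'"
    then show "\<exists>A'. act I A ChR a A' \<and> leq I ([P] @ [A']) ([] @ [B'])"
      by (auto simp: assms(3) leq_Par_iff)
  qed
  then show ?thesis by (simp add: leq_Par_iff)
qed

lemma select_Par:
  "select l (P1 \<bowtie> Q) (P2 \<bowtie> Q) = select l P1 P2 \<bowtie> Q"
  "select l (P \<bowtie> Q1) (P \<bowtie> Q2) = P \<bowtie> select l Q1 Q2"
  by (cases l; simp)+

lemma subst_id_proc [simp]: "subst (id_proc T) \<sigma> = id_proc T"
  by (induction T arbitrary: \<sigma>) auto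

lemma leq_Par_comm:
  "act I A ChR a A' \<Longrightarrow> act I B ChL (colabel a) B' \<Longrightarrow> leq I [A \<bowtie> B] [A' \<bowtie> B']"
  by (simp add: leq_Par_iff leq_comm)

text \<open>The copy that receives a message from outside forwards it to the other one. The
  resulting prefix is then moved out of the composition, leaving two shorter identities for the
  induction hypothesis.\<close>

lemma leq_id_proc: "leq I [id_proc T \<bowtie> id_proc T] [id_proc T]"
proof (induction T)
  case End
  then show ?case by (simp add: leq_Par_iff leq_Idle_Idle)
next
  case (Send t T)
  let ?i = "id_proc T :: ('b, 'a) proc"
  have step: "leq I [Out ChR (Val v) ?i, id_proc (Send t T)] [Out ChR (Val v) ?i]"
    if v: "has_btype I v t" for v
  proof -
    have "leq I [Out ChR (Val v) ?i, id_proc (Send t T)] [?i, Out ChR (Val v) ?i]"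
      by (rule leq_comm[of I _ "LOut v"]) (use v in \<open>simp_all add: inst_def\<close>)
    also have "leq I [?i, Out ChR (Val v) ?i] [Out ChR (Val v) (?i \<bowtie> ?i)]"
      using leq_up_right[of "Out ChR (Val v) ?i" "Out ChR (Val v) (?i \<bowtie> ?i)" I ?i]
      by (simp add: leq_Par_iff)
    also have "leq I [Out ChR (Val v) (?i \<bowtie> ?i)] [Out ChR (Val v) ?i]"
      using Send by (rule leq_Out)
    finally show ?thesis .
  qed
  show ?case unfolding leq_Par_iff
    by (rule leq_left_prefix) (use step in \<open>auto simp: inst_def\<close>)
next
  case (Recv t T)
  let ?i = "id_proc T :: ('b, 'a) proc"
  have step: "leq I [id_proc (Recv t T), Out ChL (Val v) ?i] [Out ChL (Val v) ?i]"
    if v: "has_btype I v t" for v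
  proof -
    have "leq I [id_proc (Recv t T), Out ChL (Val v) ?i] [Out ChL (Val v) ?i, ?i]"
      by (rule leq_comm[of I _ "LIn v"]) (use v in \<open>simp_all add: inst_def\<close>)
    also have "leq I [Out ChL (Val v) ?i, ?i] [Out ChL (Val v) (?i \<bowtie> ?i)]"
      using leq_up_left[of "Out ChL (Val v) ?i" "Out ChL (Val v) (?i \<bowtie> ?i)" I ?i]
      by (simp add: leq_Par_iff)
    also have "leq I [Out ChL (Val v) (?i \<bowtie> ?i)] [Out ChL (Val v) ?i]"
      using Recv by (rule leq_Out)
    finally show ?thesis .
  qed
  \<comment> \<open>Messages now enter from the right: the second copy is the prefix compared, and
    the first is carried along in front of it.\<close>
  have "leq I ([id_proc (Recv t T)] @ [id_proc (Recv t T)]) ([] @ [id_proc (Recv t T)])"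
    by (rule leq_right_prefix) (use step in \<open>auto simp: inst_def\<close>)
  then show ?case by (simp add: leq_Par_iff)
next
  case (Choice T S)
  let ?i = "\<lambda>l. id_proc (select l T S) :: ('b, 'a) proc"
  have step: "leq I [Sel ChR l (?i l), id_proc (Choice T S)] [Sel ChR l (?i l)]" for l
  proof -
    have "leq I [Sel ChR l (?i l), id_proc (Choice T S)] [?i l, Sel ChR l (?i l)]"
      by (rule leq_comm[of I _ "LSel l"]) (cases l; simp)+
    also have "leq I [?i l, Sel ChR l (?i l)] [Sel ChR l (?i l \<bowtie> ?i l)]"
      using leq_up_right[of "Sel ChR l (?i l)" "Sel ChR l (?i l \<bowtie> ?i l)" I "?i l"]
      by (simp add: leq_Par_iff)
    also have "leq I [Sel ChR l (?i l \<bowtie> ?i l)] [Sel ChR l (?i l)]"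
      using Choice by (intro leq_Sel) (cases l; simp)
    finally show ?thesis .
  qed
  have "select l (Sel ChR SInl (id_proc T)) (Sel ChR SInr (id_proc S)) = Sel ChR l (?i l)" for l
    by (cases l) auto
  then show ?case unfolding leq_Par_iff
    by (intro leq_left_prefix) (use step in auto)
next
  case (Branch T S)
  let ?i = "\<lambda>l. id_proc (select l T S) :: ('b, 'a) proc"
  have step: "leq I [id_proc (Branch T S), Sel ChL l (?i l)] [Sel ChL l (?i l)]" for l
  proof -
    have "leq I [id_proc (Branch T S), Sel ChL l (?i l)] [Sel ChL l (?i l), ?i l]"
      by (rule leq_comm[of I _ "LBra l"]) (cases l; simp)+
    also have "leq I [Sel ChL l (?i l), ?i l] [Sel ChL l (?i l \<bowtie> ?i l)]"
      using leq_up_left[of "Sel ChL l (?i l)" "Sel ChL l (?i l \<bowtie> ?i l)" I "?i l"]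
      by (simp add: leq_Par_iff)
    also have "leq I [Sel ChL l (?i l \<bowtie> ?i l)] [Sel ChL l (?i l)]"
      using Branch by (intro leq_Sel) (cases l; simp)
    finally show ?thesis .
  qed
  have "select l (Sel ChL SInl (id_proc T)) (Sel ChL SInr (id_proc S)) = Sel ChL l (?i l)" for l
    by (cases l) auto
  then have "leq I ([id_proc (Branch T S)] @ [id_proc (Branch T S)]) ([] @ [id_proc (Branch T S)])"
    by (intro leq_right_prefix) (use step in auto)
  then show ?case by (simp add: leq_Par_iff)
qed

text \<open>Under an input, the received value extends the closing substitution; this is why the
  assumption covers every \<Gamma> and \<sigma>.\<close>

lemma leq_splug:
  assumes "\<And>\<Gamma> \<Delta> \<sigma>. typed I \<Gamma> P \<Delta> \<Longrightarrow> closing I \<Gamma> \<sigma> \<Longrightarrow> leq I [subst P \<sigma>] [subst Q \<sigma>]"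
    and "typed I \<Gamma> (splug E P) \<Delta>" "closing I \<Gamma> \<sigma>"
  shows "leq I [subst (splug E P) \<sigma>] [subst (splug E Q) \<sigma>]"
  using assms(2,3)
proof (induction E arbitrary: \<Gamma> \<Delta> \<sigma>)
  case (SInp c t E)
  then obtain T where T: "typed I (t # \<Gamma>) (splug E P) (\<Delta>(c := T))" by (auto simp: typed_Inp)
  show ?case using SInp.IH[OF T closing_Cons[OF _ SInp.prems(2)]] by (auto intro: leq_Inp)
qed (auto simp: typed_iffs intro!: leq_Out leq_Sel leq_Bra leq_Cond_cong intro: assms(1))

section \<open>The swap rules under a substitution\<close>

lemma leq_swap_inp_inp:
  "leq I [subst (Inp c t (Inp (co c) s P)) \<sigma>] [subst (Inp (co c) s (Inp c t (exchange P))) \<sigma>]"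
  by (rule leq_swap[of _ c]) (auto simp: act_subst simp del: subst.simps)

lemma leq_swap_out_out:
  "leq I [subst (Out c e (Out (co c) f P)) \<sigma>] [subst (Out (co c) f (Out c e P)) \<sigma>]"
  by (rule leq_swap[of _ c]) (auto simp: act_subst simp del: subst.simps)

text \<open>Below the input, \<open>Suc y\<close> still denotes \<open>\<sigma> y\<close>, whatever
  value was received, so both orders send the same value.\<close>

lemma leq_swap_inp_out:
  "leq I [subst (Inp c t (Out (co c) (Var (Suc y)) P)) \<sigma>]
    [subst (Out (co c) (Var y) (Inp c t P)) \<sigma>]"
  by (rule leq_swap[of _ c]) (auto simp: act_subst simp del: subst.simps)

lemma leq_swap_inp_sel:
  "leq I [subst (Inp c t (Sel (co c) l P)) \<sigma>] [subst (Sel (co c) l (Inp c t P)) \<sigma>]"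
  by (rule leq_swap[of _ c]) (auto simp: act_subst simp del: subst.simps)

lemma leq_swap_out_sel:
  "leq I [subst (Out c e (Sel (co c) l P)) \<sigma>] [subst (Sel (co c) l (Out c e P)) \<sigma>]"
  by (rule leq_swap[of _ c]) (auto simp: act_subst simp del: subst.simps)

lemma leq_swap_inp_bra:
  "leq I [subst (Inp c t (Bra (co c) P Q)) \<sigma>] [subst (Bra (co c) (Inp c t P) (Inp c t Q)) \<sigma>]"
  by (rule leq_swap[of _ c]) (auto simp: act_subst simp del: subst.simps)

lemma leq_swap_out_bra:
  "leq I [subst (Out c e (Bra (co c) P Q)) \<sigma>] [subst (Bra (co c) (Out c e P) (Out c e Q)) \<sigma>]"
  by (rule leq_swap[of _ c]) (auto simp: act_subst simp del: subst.simps)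

lemma leq_swap_bra_sel:
  "leq I [subst (Bra c (Sel (co c) l P) (Sel (co c) l Q)) \<sigma>] [subst (Sel (co c) l (Bra c P Q)) \<sigma>]"
  by (rule leq_swap[of _ c]) (auto simp: act_subst simp del: subst.simps)

lemma leq_swap_sel_sel:
  "leq I [subst (Sel c l (Sel (co c) l' P)) \<sigma>] [subst (Sel (co c) l' (Sel c l P)) \<sigma>]"
  by (rule leq_swap[of _ c]) (auto simp: act_subst simp del: subst.simps)

lemma leq_swap_bra_bra:
  "leq I [subst (Bra c (Bra (co c) P1 Q1) (Bra (co c) P2 Q2)) \<sigma>]
    [subst (Bra (co c) (Bra c P1 P2) (Bra c Q1 Q2)) \<sigma>]"
  by (rule leq_swap[of _ c]) (auto simp: act_subst simp del: subst.simps; metis select_select)+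

lemma symred_leq:
  "P \<leadsto> Q \<Longrightarrow> typed I \<Gamma> P \<Delta> \<Longrightarrow> closing I \<Gamma> \<sigma> \<Longrightarrow> leq I [subst P \<sigma>] [subst Q \<sigma>]"
proof (induction arbitrary: \<Gamma> \<Delta> \<sigma> rule: symred.induct)
  case (up_inp_l t P Q)
  show ?case unfolding subst.simps(7)
    by (rule leq_up_left) (auto simp: act_subst simp del: subst.simps(1-6))
next
  case (up_inp_r P t Q)
  show ?case unfolding subst.simps(7)
    by (rule leq_up_right) (auto simp: act_subst simp del: subst.simps(1-6))
next
  case up_out_l
  show ?case unfolding subst.simps(7) by (rule leq_up_left) auto
next
  case up_out_r
  show ?case unfolding subst.simps(7) by (rule leq_up_right) auto
next
  case up_bra_l
  show ?case unfolding subst.simps(7) by (rule leq_up_left) (auto simp: select_Par)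
next
  case up_bra_r
  show ?case unfolding subst.simps(7) by (rule leq_up_right) (auto simp: select_Par)
next
  case up_sel_l
  show ?case unfolding subst.simps(7) by (rule leq_up_left) auto
next
  case up_sel_r
  show ?case unfolding subst.simps(7) by (rule leq_up_right) auto
next
  case (up_cond_l x P1 P2 Q)
  from up_cond_l.prems(1) have "expr_typed I \<Gamma> (Var x) TBool" unfolding typed_iffs by blast
  with up_cond_l.prems(2) obtain b where b: "eval (\<sigma> x) (VBool b)" by (metis closing_TBool eval_Val)
  \<comment> \<open>The common outcome of both sides once the guard has been evaluated.\<close>
  let ?X = "subst (if b then P1 else P2) \<sigma> \<bowtie> subst Q \<sigma>"
  have "leq I [subst (Cond (Var x) P1 P2 \<bowtie> Q) \<sigma>] [?X]"
    using leq_Par_cong[OF leq_Cond[OF b, of I "subst P1 \<sigma>" "subst P2 \<sigma>"]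
      leq_refl[of I "[subst Q \<sigma>]"]] by (cases b) simp_all
  moreover have "leq I [subst (Cond (Var x) (P1 \<bowtie> Q) (P2 \<bowtie> Q)) \<sigma>] [?X]"
    using leq_Cond[OF b, of I "subst (P1 \<bowtie> Q) \<sigma>" "subst (P2 \<bowtie> Q) \<sigma>"] by (cases b) simp_all
  ultimately show ?case using leq_trans leq_sym by blast
next
  case (up_cond_r P x Q1 Q2)
  from up_cond_r.prems(1) have "expr_typed I \<Gamma> (Var x) TBool" unfolding typed_iffs by blast
  with up_cond_r.prems(2) obtain b where b: "eval (\<sigma> x) (VBool b)" by (metis closing_TBool eval_Val)
  let ?X = "subst P \<sigma> \<bowtie> subst (if b then Q1 else Q2) \<sigma>"
  have "leq I [subst (P \<bowtie> Cond (Var x) Q1 Q2) \<sigma>] [?X]"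
    using leq_Par_cong[OF leq_refl[of I "[subst P \<sigma>]"]
      leq_Cond[OF b, of I "subst Q1 \<sigma>" "subst Q2 \<sigma>"]] by (cases b) simp_all
  moreover have "leq I [subst (Cond (Var x) (P \<bowtie> Q1) (P \<bowtie> Q2)) \<sigma>] [?X]"
    using leq_Cond[OF b, of I "subst (P \<bowtie> Q1) \<sigma>" "subst (P \<bowtie> Q2) \<sigma>"] by (cases b) simp_all
  ultimately show ?case using leq_trans leq_sym by blast
next
  case (cond x c P)
  from cond.prems(1) have "expr_typed I \<Gamma> (Var x) TBool" unfolding typed_iffs by blast
  with cond.prems(2) obtain b where b: "\<sigma> x = Val (VBool b)" by (rule closing_TBool)
  \<comment> \<open>The branch taken sends exactly the constant that \<sigma> assigns to
    \<open>x\<close>.\<close>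
  then show ?case
    using leq_Cond[of "\<sigma> x" b I] by (cases b) auto
next
  case (comm_r y P t Q)
  from comm_r.prems(1) have "expr_typed I \<Gamma> (Var y) t" by (auto simp: typed_iffs)
  with comm_r.prems(2) obtain v where v: "\<sigma> y = Val v" "has_btype I v t" by (rule closing_Var)
  show ?case unfolding subst.simps(7)
    by (rule leq_Par_comm[of I _ "LOut v"]) (use v in \<open>auto simp: subst_inst_Var\<close>)
next
  case (comm_l t P y Q)
  from comm_l.prems(1) have "expr_typed I \<Gamma> (Var y) t" by (auto simp: typed_iffs)
  with comm_l.prems(2) obtain v where v: "\<sigma> y = Val v" "has_btype I v t" by (rule closing_Var)
  show ?case unfolding subst.simps(7)
    by (rule leq_Par_comm[of I _ "LIn v"]) (use v in \<open>auto simp: subst_inst_Var\<close>)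
next
  case (comm_sel_r l P Q1 Q2)
  show ?case unfolding subst.simps(7)
    by (rule leq_Par_comm[of I _ "LSel l"]) (auto simp: subst_select)
next
  case (comm_sel_l P1 P2 l Q)
  show ?case unfolding subst.simps(7)
    by (rule leq_Par_comm[of I _ "LBra l"]) (auto simp: subst_select)
next
  case (ident T)
  show ?case by (simp add: leq_id_proc)
next
  case (ctx P Q E)
  then show ?case using leq_splug by blast
qed (rule leq_swap_inp_inp leq_swap_out_out leq_swap_inp_out leq_swap_inp_sel leq_swap_out_sel
  leq_swap_inp_bra leq_swap_out_bra leq_swap_bra_sel leq_swap_sel_sel leq_swap_bra_bra
  leq_swap_inp_out[THEN leq_sym] leq_swap_inp_sel[THEN leq_sym] leq_swap_out_sel[THEN leq_sym]
  leq_swap_inp_bra[THEN leq_sym] leq_swap_out_bra[THEN leq_sym] leq_swap_bra_sel[THEN leq_sym]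
  leq_swap_sel_sel[THEN leq_sym] leq_swap_bra_bra[THEN leq_sym])+

theorem theorem2:
  fixes I :: "'t \<Rightarrow> 'v set"
    and P Q :: "('v, 't) proc"
    and T S :: "'t stype"
  assumes "fv P = {}"
    and "typed I [] P (sess ChL T S)"
    and "symred\<^sup>*\<^sup>* P Q"
  shows "equivalent I P Q"
proof -
  \<comment> \<open>Typing is part of the invariant so that \<open>symred_leq\<close> applies to
    each further step.\<close>
  from assms(3) have "typed I [] Q (sess ChL T S) \<and> leq I [P] [Q]"
  proof (induction rule: rtranclp_induct)
    case base
    then show ?case using assms(2) by simp
  next
    case (step Q R)
    then have "leq I [Q] [R]"
      \<comment> \<open>Any substitution closes the empty environment; \<open>Var\<close> leaves
        both processes unchanged.\<close>
      using symred_leq[of Q R I "[]" _ Var] by (auto simp: closing_def)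
    then show ?case using step symred_typed leq_trans by blast
  qed
  then show ?thesis using leq_equivalent by blast
qed

end
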